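(* Let $r\in\wedge^2\mathfrak g$ be an invertible solution of the Classical Yang–Baxter Equation on a Lie group $G$ with Lie algebra $\mathfrak g$. Then every Lie group whose Lie algebra is isomorphic to the double Lie algebra $\mathcal D=\mathfrak g\oplus\mathfrak g^*$ of the Poisson Lie group $(G,\pi:=r^+-r^-)$ is endowed with a left invariant affine structure. The associated left symmetric algebra structure on $\mathcal D$, compatible with the Lie bracket of $\mathcal D$, is given by $$(x,\alpha)(y,\beta)=(xy+ad^*_\alpha y,\ \alpha\beta+ad^*_x\beta),\qquad x,y\in\mathfrak g,\ \alpha,\beta\in\mathfrak g^*.$$
   Context: Lie groups and Lie algebras are real and finite-dimensional; $\langle\cdot,\cdot\rangle$ is the evaluation pairing. An element $r\in\wedge^2\mathfrak g$ is identified with the skew-symmetric linear map $r:\mathfrak g^*\to\mathfrak g$, $r(\alpha)=r(\alpha,\cdot)$. It is a solution of the Classical Yang–Baxter Equation (CYBE) if $\langle[r(\alpha),r(\beta)],\gamma\rangle+\langle[r(\beta),r(\gamma)],\alpha\rangle+\langle[r(\gamma),r(\alpha)],\beta\rangle=0$ for all $\alpha,\beta,\gamma\in\mathfrak g^*$; it is invertible if the map $r$ is. Here $r^+$ (resp. $r^-$) is the left (resp. right) invariant bivector field on $G$ with value $r$ at the unit. Coadjoint actions: for $x,y\in\mathfrak g$, $\alpha\in\mathfrak g^*$, $\langle ad^*_x\alpha,y\rangle=-\langle\alpha,[x,y]\rangle$. The dual Lie algebra of $(G,\pi)$ is $\mathfrak g^*$ with bracket $[\alpha,\beta]_r=ad^*_{r(\alpha)}\beta-ad^*_{r(\beta)}\alpha$,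 and its coadjoint action on $\mathfrak g$ is $\langle ad^*_\alpha y,\beta\rangle=-\langle[\alpha,\beta]_r,y\rangle$. The double Lie algebra is $\mathcal D=\mathfrak g\oplus\mathfrak g^*$ with bracket $[(x,\alpha),(y,\beta)]=([x,y]+ad^*_\alpha y-ad^*_\beta x,\ [\alpha,\beta]_r+ad^*_x\beta-ad^*_y\alpha)$. For invertible $r$, $\omega(x,y):=\langle r^{-1}(x),y\rangle$ is a symplectic form on $\mathfrak g$ (nondegenerate 2-cocycle); the product $xy$ on $\mathfrak g$ is defined by $\omega(xy,z)=-\omega(y,[x,z])$ for all $z\in\mathfrak g$, and the product on $\mathfrak g^*$ by $\alpha\beta:=ad^*_{r(\alpha)}\beta$. A left symmetric algebra is a vector space with a bilinear product such that $(ab)c-a(bc)=(ba)c-b(ac)$; compatible with a Lie bracket means $ab-ba=[a,b]$. A left invariant affine structure on a Lie group is a left invariant flat torsion free connection; its associated left symmetric product on the Lie algebra is given by $\nabla_{a^+}b^+=(ab)^+$, where $a^+$ is the left invariant vector field with value $a$ at the unit. *)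

theory Defs
  imports "HOL-Analysis.Analysis" "HOL-Algebra.Group"
begin

section \<open>Finite-dimensional real vector spaces and their duals\<close>

text \<open>Unlike \<^class>\<open>euclidean_space\<close>, these classes also admit the zero-dimensional space.\<close>

class fin_dim_vector = real_vector +
  assumes finite_spanning_set: "\<exists>B. finite B \<and> (\<forall>x. \<exists>c. x = (\<Sum>b\<in>B. c b *\<^sub>R b))"

class fin_dim_inner = real_inner + fin_dim_vector

instance euclidean_space \<subseteq> fin_dim_inner
  by standard (metis euclidean_representation finite_Basis)

typedef (overloaded) 'a dual = "{f :: 'a::real_vector \<Rightarrow> real. linear f}"
  morphisms pairing Abs_dual
  by (rule exI[of _ "\<lambda>x. 0"]) (simp add: linear_iff)

setup_lifting type_definition_dual

instantiation dual :: (real_vector) real_vector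
begin

lift_definition zero_dual :: "'a dual" is "\<lambda>x. 0"
  by (simp add: linear_iff)

lift_definition plus_dual :: "'a dual \<Rightarrow> 'a dual \<Rightarrow> 'a dual" is "\<lambda>f g x. f x + g x"
  by (rule linear_compose_add)

lift_definition uminus_dual :: "'a dual \<Rightarrow> 'a dual" is "\<lambda>f x. - f x"
  by (rule linear_compose_neg)

lift_definition minus_dual :: "'a dual \<Rightarrow> 'a dual \<Rightarrow> 'a dual" is "\<lambda>f g x. f x - g x"
  by (rule linear_compose_sub)

lift_definition scaleR_dual :: "real \<Rightarrow> 'a dual \<Rightarrow> 'a dual" is "\<lambda>c f x. c * f x"
  by (simp add: linear_iff algebra_simps)

instance
  by standard (transfer; simp add: fun_eq_iff algebra_simps)+

end


section \<open>Lie algebras and left symmetric algebras\<close>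

definition lie_algebra :: "('a::real_vector \<Rightarrow> 'a \<Rightarrow> 'a) \<Rightarrow> bool" where
  "lie_algebra br \<longleftrightarrow> bilinear br \<and> (\<forall>x. br x x = 0) \<and>
     (\<forall>x y z. br x (br y z) + br y (br z x) + br z (br x y) = 0)"

definition left_symmetric_algebra :: "('a::real_vector \<Rightarrow> 'a \<Rightarrow> 'a) \<Rightarrow> bool" where
  "left_symmetric_algebra m \<longleftrightarrow> bilinear m \<and>
     (\<forall>a b c. m (m a b) c - m a (m b c) = m (m b a) c - m b (m a c))"

definition compatible_with :: "('a::real_vector \<Rightarrow> 'a \<Rightarrow> 'a) \<Rightarrow> ('a \<Rightarrow> 'a \<Rightarrow> 'a) \<Rightarrow> bool" where
  "compatible_with m br \<longleftrightarrow> (\<forall>a b. m a b - m b a = br a b)"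


section \<open>The double Lie algebra of an $r$-matrix\<close>

text \<open>Throughout, \<open>br\<close> is the bracket of $\mathfrak g$, and an element \<open>r\<close> of $\wedge^2\mathfrak g$
  is given as a skew-symmetric linear map $\mathfrak g^* \to \mathfrak g$.\<close>

definition skew_map :: "('a::real_vector dual \<Rightarrow> 'a) \<Rightarrow> bool" where
  "skew_map r \<longleftrightarrow> linear r \<and> (\<forall>\<alpha> \<beta>. pairing \<beta> (r \<alpha>) = - pairing \<alpha> (r \<beta>))"

definition cybe :: "('a::real_vector \<Rightarrow> 'a \<Rightarrow> 'a) \<Rightarrow> ('a dual \<Rightarrow> 'a) \<Rightarrow> bool" where
  "cybe br r \<longleftrightarrow> (\<forall>\<alpha> \<beta> \<gamma>.
     pairing \<gamma> (br (r \<alpha>) (r \<beta>)) + pairing \<alpha> (br (r \<beta>) (r \<gamma>)) + pairing \<beta> (br (r \<gamma>) (r \<alpha>)) = 0)"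

definition coad :: "('a::real_vector \<Rightarrow> 'a \<Rightarrow> 'a) \<Rightarrow> 'a \<Rightarrow> 'a dual \<Rightarrow> 'a dual" where
  "coad br x \<alpha> = Abs_dual (\<lambda>y. - pairing \<alpha> (br x y))"

definition dual_bracket ::
    "('a::real_vector \<Rightarrow> 'a \<Rightarrow> 'a) \<Rightarrow> ('a dual \<Rightarrow> 'a) \<Rightarrow> 'a dual \<Rightarrow> 'a dual \<Rightarrow> 'a dual" where
  "dual_bracket br r \<alpha> \<beta> = coad br (r \<alpha>) \<beta> - coad br (r \<beta>) \<alpha>"

text \<open>The coadjoint action of $(\mathfrak g^*, [\cdot,\cdot]_r)$ on $\mathfrak g^{**} = \mathfrak g$.\<close>

definition dual_coad ::
    "('a::real_vector \<Rightarrow> 'a \<Rightarrow> 'a) \<Rightarrow> ('a dual \<Rightarrow> 'a) \<Rightarrow> 'a dual \<Rightarrow> 'a \<Rightarrow> 'a" where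
  "dual_coad br r \<alpha> y = (THE w. \<forall>\<beta>. pairing \<beta> w = - pairing (dual_bracket br r \<alpha> \<beta>) y)"

definition double_bracket ::
    "('a::real_vector \<Rightarrow> 'a \<Rightarrow> 'a) \<Rightarrow> ('a dual \<Rightarrow> 'a) \<Rightarrow> 'a \<times> 'a dual \<Rightarrow> 'a \<times> 'a dual \<Rightarrow> 'a \<times> 'a dual" where
  "double_bracket br r = (\<lambda>(x, \<alpha>) (y, \<beta>).
     (br x y + dual_coad br r \<alpha> y - dual_coad br r \<beta> x,
      dual_bracket br r \<alpha> \<beta> + coad br x \<beta> - coad br y \<alpha>))"

definition symp_form :: "('a::real_vector dual \<Rightarrow> 'a) \<Rightarrow> 'a \<Rightarrow> 'a \<Rightarrow> real" where
  "symp_form r x y = pairing (the_inv r x) y"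

definition symp_prod ::
    "('a::real_vector \<Rightarrow> 'a \<Rightarrow> 'a) \<Rightarrow> ('a dual \<Rightarrow> 'a) \<Rightarrow> 'a \<Rightarrow> 'a \<Rightarrow> 'a" where
  "symp_prod br r x y = (THE w. \<forall>z. symp_form r w z = - symp_form r y (br x z))"

definition dual_prod ::
    "('a::real_vector \<Rightarrow> 'a \<Rightarrow> 'a) \<Rightarrow> ('a dual \<Rightarrow> 'a) \<Rightarrow> 'a dual \<Rightarrow> 'a dual \<Rightarrow> 'a dual" where
  "dual_prod br r \<alpha> \<beta> = coad br (r \<alpha>) \<beta>"

definition double_prod ::
    "('a::real_vector \<Rightarrow> 'a \<Rightarrow> 'a) \<Rightarrow> ('a dual \<Rightarrow> 'a) \<Rightarrow> 'a \<times> 'a dual \<Rightarrow> 'a \<times> 'a dual \<Rightarrow> 'a \<times> 'a dual" where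
  "double_prod br r = (\<lambda>(x, \<alpha>) (y, \<beta>).
     (symp_prod br r x y + dual_coad br r \<alpha> y, dual_prod br r \<alpha> \<beta> + coad br x \<beta>))"


section \<open>Smooth manifolds\<close>

text \<open>In finite dimension, and on an open set, being $C^{k+1}$ amounts to being differentiable
  with all directional derivatives of class $C^k$.\<close>

primrec Ck_on :: "nat \<Rightarrow> 'a::real_normed_vector set \<Rightarrow> ('a \<Rightarrow> 'b::real_normed_vector) \<Rightarrow> bool" where
  "Ck_on 0 S f \<longleftrightarrow> continuous_on S f"
| "Ck_on (Suc k) S f \<longleftrightarrow> (\<forall>x\<in>S. f differentiable (at x)) \<and>
     (\<forall>v. Ck_on k S (\<lambda>x. frechet_derivative f (at x) v))"

definition smooth_on :: "'a::real_normed_vector set \<Rightarrow> ('a \<Rightarrow> 'b::real_normed_vector) \<Rightarrow> bool" where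
  "smooth_on S f \<longleftrightarrow> (\<forall>k. Ck_on k S f)"

text \<open>A chart is a pair of its domain and its coordinate map. Atlases need not be maximal, and
  the manifold is the whole type.\<close>

type_synonym ('m, 'e) atlas = "('m set \<times> ('m \<Rightarrow> 'e)) set"

definition smooth_atlas :: "('m::topological_space, 'e::real_normed_vector) atlas \<Rightarrow> bool" where
  "smooth_atlas A \<longleftrightarrow> (\<Union>(U, \<phi>)\<in>A. U) = UNIV \<and>
     (\<forall>(U, \<phi>)\<in>A. open U \<and> open (\<phi> ` U) \<and> (\<exists>\<psi>. homeomorphism U (\<phi> ` U) \<phi> \<psi>)) \<and>
     (\<forall>(U, \<phi>)\<in>A. \<forall>(V, \<psi>)\<in>A. smooth_on (\<phi> ` (U \<inter> V)) (\<psi> \<circ> the_inv_into U \<phi>))"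

definition prod_atlas :: "('m, 'e) atlas \<Rightarrow> ('n, 'f) atlas \<Rightarrow> ('m \<times> 'n, 'e \<times> 'f) atlas" where
  "prod_atlas A B = {(U \<times> V, map_prod \<phi> \<psi>) | U \<phi> V \<psi>. (U, \<phi>) \<in> A \<and> (V, \<psi>) \<in> B}"

definition smooth_map ::
    "('m::topological_space, 'e::real_normed_vector) atlas \<Rightarrow>
     ('n::topological_space, 'f::real_normed_vector) atlas \<Rightarrow> ('m \<Rightarrow> 'n) \<Rightarrow> bool" where
  "smooth_map A B F \<longleftrightarrow> continuous_on UNIV F \<and>
     (\<forall>(U, \<phi>)\<in>A. \<forall>(V, \<psi>)\<in>B. smooth_on (\<phi> ` (U \<inter> F -` V)) (\<psi> \<circ> F \<circ> the_inv_into U \<phi>))"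

definition smooth_functions :: "('m, 'e::real_normed_vector) atlas \<Rightarrow> ('m \<Rightarrow> real) set" where
  "smooth_functions A = {f. \<forall>(U, \<phi>)\<in>A. smooth_on (\<phi> ` U) (f \<circ> the_inv_into U \<phi>)}"


section \<open>Vector fields and affine connections\<close>

text \<open>Vector fields are the derivations of the algebra of smooth functions. They are made total
  by the value 0 outside that algebra, so that equal derivations are equal functions.\<close>

type_synonym 'm operator = "('m \<Rightarrow> real) \<Rightarrow> ('m \<Rightarrow> real)"

definition vector_fields :: "('m, 'e::real_normed_vector) atlas \<Rightarrow> 'm operator set" where
  "vector_fields A = {X.
     (\<forall>f\<in>smooth_functions A. X f \<in> smooth_functions A) \<and>
     (\<forall>f. f \<notin> smooth_functions A \<longrightarrow> X f = (\<lambda>p. 0)) \<and>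
     (\<forall>f\<in>smooth_functions A. \<forall>g\<in>smooth_functions A. X (\<lambda>p. f p + g p) = (\<lambda>p. X f p + X g p)) \<and>
     (\<forall>c. \<forall>f\<in>smooth_functions A. X (\<lambda>p. c * f p) = (\<lambda>p. c * X f p)) \<and>
     (\<forall>f\<in>smooth_functions A. \<forall>g\<in>smooth_functions A.
        X (\<lambda>p. f p * g p) = (\<lambda>p. X f p * g p + f p * X g p))}"

definition vf_add :: "'m operator \<Rightarrow> 'm operator \<Rightarrow> 'm operator" where
  "vf_add X Y = (\<lambda>f p. X f p + Y f p)"

definition vf_diff :: "'m operator \<Rightarrow> 'm operator \<Rightarrow> 'm operator" where
  "vf_diff X Y = (\<lambda>f p. X f p - Y f p)"

definition vf_scale :: "('m \<Rightarrow> real) \<Rightarrow> 'm operator \<Rightarrow> 'm operator" where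
  "vf_scale h X = (\<lambda>f p. h p * X f p)"

definition vf_bracket :: "'m operator \<Rightarrow> 'm operator \<Rightarrow> 'm operator" where
  "vf_bracket X Y = (\<lambda>f p. X (Y f) p - Y (X f) p)"

definition affine_connection ::
    "('m, 'e::real_normed_vector) atlas \<Rightarrow> ('m operator \<Rightarrow> 'm operator \<Rightarrow> 'm operator) \<Rightarrow> bool" where
  "affine_connection A D \<longleftrightarrow>
     (\<forall>X\<in>vector_fields A. \<forall>Y\<in>vector_fields A. D X Y \<in> vector_fields A) \<and>
     (\<forall>X\<in>vector_fields A. \<forall>X'\<in>vector_fields A. \<forall>Y\<in>vector_fields A.
        D (vf_add X X') Y = vf_add (D X Y) (D X' Y)) \<and>
     (\<forall>h\<in>smooth_functions A. \<forall>X\<in>vector_fields A. \<forall>Y\<in>vector_fields A.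
        D (vf_scale h X) Y = vf_scale h (D X Y)) \<and>
     (\<forall>X\<in>vector_fields A. \<forall>Y\<in>vector_fields A. \<forall>Y'\<in>vector_fields A.
        D X (vf_add Y Y') = vf_add (D X Y) (D X Y')) \<and>
     (\<forall>h\<in>smooth_functions A. \<forall>X\<in>vector_fields A. \<forall>Y\<in>vector_fields A.
        D X (vf_scale h Y) = vf_add (vf_scale (X h) Y) (vf_scale h (D X Y)))"

definition torsion_free ::
    "('m, 'e::real_normed_vector) atlas \<Rightarrow> ('m operator \<Rightarrow> 'm operator \<Rightarrow> 'm operator) \<Rightarrow> bool" where
  "torsion_free A D \<longleftrightarrow> (\<forall>X\<in>vector_fields A. \<forall>Y\<in>vector_fields A.
     vf_diff (D X Y) (D Y X) = vf_bracket X Y)"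

definition flat ::
    "('m, 'e::real_normed_vector) atlas \<Rightarrow> ('m operator \<Rightarrow> 'm operator \<Rightarrow> 'm operator) \<Rightarrow> bool" where
  "flat A D \<longleftrightarrow> (\<forall>X\<in>vector_fields A. \<forall>Y\<in>vector_fields A. \<forall>Z\<in>vector_fields A.
     vf_diff (D X (D Y Z)) (D Y (D X Z)) = D (vf_bracket X Y) Z)"


section \<open>Lie groups\<close>

definition lie_group ::
    "('m::{t2_space, second_countable_topology}, 'b) monoid_scheme \<Rightarrow> ('m, 'e::fin_dim_inner) atlas \<Rightarrow> bool" where
  "lie_group G A \<longleftrightarrow> group G \<and> carrier G = UNIV \<and> smooth_atlas A \<and>
     smooth_map (prod_atlas A A) A (\<lambda>(p, q). p \<otimes>\<^bsub>G\<^esub> q) \<and>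
     smooth_map A A (\<lambda>p. inv\<^bsub>G\<^esub> p)"

text \<open>The pushforward of \<open>X\<close> by the left translation \<open>L\<^sub>g\<close>, i.e.
  $((L_g)_* X) f = X(f \circ L_g) \circ L_g^{-1}$.\<close>

definition left_push :: "('m, 'b) monoid_scheme \<Rightarrow> 'm \<Rightarrow> 'm operator \<Rightarrow> 'm operator" where
  "left_push G g X = (\<lambda>f p. X (\<lambda>q. f (g \<otimes>\<^bsub>G\<^esub> q)) (inv\<^bsub>G\<^esub> g \<otimes>\<^bsub>G\<^esub> p))"

definition left_invariant_fields ::
    "('m, 'b) monoid_scheme \<Rightarrow> ('m, 'e::real_normed_vector) atlas \<Rightarrow> 'm operator set" where
  "left_invariant_fields G A = {X \<in> vector_fields A. \<forall>g. left_push G g X = X}"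

text \<open>\<open>\<phi>\<close> is an isomorphism from the Lie algebra with bracket \<open>br\<close> onto the Lie algebra of \<open>G\<close>,
  the latter realised by the left invariant vector fields: \<open>\<phi> a\<close> is the field $a^+$.\<close>

definition is_lie_algebra_of ::
    "('a::real_vector \<Rightarrow> 'a \<Rightarrow> 'a) \<Rightarrow> ('m, 'b) monoid_scheme \<Rightarrow> ('m, 'e::real_normed_vector) atlas \<Rightarrow>
     ('a \<Rightarrow> 'm operator) \<Rightarrow> bool" where
  "is_lie_algebra_of br G A \<phi> \<longleftrightarrow>
     bij_betw \<phi> UNIV (left_invariant_fields G A) \<and>
     (\<forall>a b. \<phi> (a + b) = vf_add (\<phi> a) (\<phi> b)) \<and>
     (\<forall>c a. \<phi> (c *\<^sub>R a) = vf_scale (\<lambda>p. c) (\<phi> a)) \<and>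
     (\<forall>a b. \<phi> (br a b) = vf_bracket (\<phi> a) (\<phi> b))"

definition left_invariant_connection ::
    "('m, 'b) monoid_scheme \<Rightarrow> ('m, 'e::real_normed_vector) atlas \<Rightarrow>
     ('m operator \<Rightarrow> 'm operator \<Rightarrow> 'm operator) \<Rightarrow> bool" where
  "left_invariant_connection G A D \<longleftrightarrow> (\<forall>g. \<forall>X\<in>vector_fields A. \<forall>Y\<in>vector_fields A.
     left_push G g (D X Y) = D (left_push G g X) (left_push G g Y))"

definition left_invariant_affine_structure ::
    "('m, 'b) monoid_scheme \<Rightarrow> ('m, 'e::real_normed_vector) atlas \<Rightarrow>
     ('m operator \<Rightarrow> 'm operator \<Rightarrow> 'm operator) \<Rightarrow> bool" where
  "left_invariant_affine_structure G A D \<longleftrightarrow>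
     affine_connection A D \<and> left_invariant_connection G A D \<and> flat A D \<and> torsion_free A D"

end

theory Submission
  imports Defs
begin

text \<open>Because $r$ intertwines $[\cdot,\cdot]_r$ with the bracket of $\mathfrak g$, it identifies
  $\mathfrak g^*$ with $\mathfrak g$ as left symmetric algebras. Under this identification the product
  on the double reads $(x, \xi)(y, \eta) = ((x + \xi) y, (x + \xi) \eta)$, and
  $(x, \xi) \mapsto x + \xi$ is multiplicative, so left symmetry is inherited from $\mathfrak g$.

  At each point a derivation of the smooth functions is a tangent vector (Hadamard's lemma), so
  spreading it over the group by left translations gives a left invariant field. Hence the left
  invariant fields form a global smooth frame, in which vector fields become functions $u, v$ with
  values in the Lie algebra. The connection is $\nabla_u v = u(v) + u \cdot v$; its torsion and
  curvature vanish precisely because the product is compatible with the bracket and left symmetric.\<close>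

section \<open>Finite-dimensional spaces\<close>

text \<open>Left multiplication by \<open>x\<close> is the coadjoint action of \<open>x\<close>
  carried from the dual to the Lie algebra by \<open>r\<close>. It is a representation by the Jacobi
  identity, and once the product is compatible with the bracket, left symmetry says exactly this.
  The Yang-Baxter equation enters through compatibility. On the analytic side the obstacle is that
  fields are operators on globally defined functions, so they cannot simply be restricted to a
  chart. Cut-off functions replace restriction, and the Hausdorff property makes their extensions by
  zero smooth. The Lie algebra is a bare vector space without a norm, so smoothness and derivatives
  of functions with values in it are tested on linear functionals. Each functional is the
  differential at the unit of some smooth function, which is what makes the frame coefficients of a
  field smooth. The classes of spaces include dimension zero; orthonormal bases, compactness of
  balls and boundedness of linear maps are established for them directly.\<close>

lemma fin_dim_vector_finite_span: "\<exists>B::'a::fin_dim_vector set. finite B \<and> span B = UNIV"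
proof -
  obtain B :: "'a set" where B: "finite B" "\<forall>x. \<exists>c. x = (\<Sum>b\<in>B. c b *\<^sub>R b)"
    using finite_spanning_set[where 'a = 'a] by auto
  have "x \<in> span B" for x
  proof -
    obtain c where "x = (\<Sum>b\<in>B. c b *\<^sub>R b)" using B(2) by auto
    then show ?thesis by (auto intro!: span_sum span_scale intro: span_base)
  qed
  with B(1) show ?thesis by auto
qed

lemma finite_span_imp_spanning:
  assumes "finite B" "span B = UNIV"
  shows "\<exists>c. x = (\<Sum>b\<in>B. c b *\<^sub>R b)"
  using assms span_finite[of B] by (auto simp: set_eq_iff image_iff)

lemma fin_dim_vector_basis:
  "\<exists>B::'a::fin_dim_vector set. finite B \<and> independent B \<and> span B = UNIV"
proof -
  obtain B :: "'a set" where B: "finite B" "span B = UNIV"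
    using fin_dim_vector_finite_span by blast
  obtain C where "C \<subseteq> B" "independent C" "B \<subseteq> span C"
    using maximal_independent_subset[of B] by blast
  with B show ?thesis
    by (metis finite_subset span_eq span_mono span_span top.extremum_uniqueI)
qed

instance prod :: (fin_dim_vector, fin_dim_vector) fin_dim_vector
proof
  obtain B :: "'a set" where B: "finite B" "span B = UNIV"
    using fin_dim_vector_finite_span by blast
  obtain C :: "'b set" where C: "finite C" "span C = UNIV"
    using fin_dim_vector_finite_span by blast
  let ?D = "(\<lambda>b. (b, 0)) ` B \<union> (\<lambda>c. (0, c)) ` C"
  have l1: "linear (\<lambda>b::'a. (b, 0::'b))" and l2: "linear (\<lambda>c::'b. (0::'a, c))"
    by (auto simp: linear_iff)
  have "x \<in> span ?D" for x :: "'a \<times> 'b"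
  proof -
    have "(fst x, 0) \<in> span ((\<lambda>b. (b, 0::'b)) ` B)"
      using linear_span_image[OF l1, of B] B by auto
    moreover have "(0, snd x) \<in> span ((\<lambda>c. (0::'a, c)) ` C)"
      using linear_span_image[OF l2, of C] C by auto
    ultimately have "(fst x, 0) \<in> span ?D" "(0, snd x) \<in> span ?D"
      by (meson in_mono span_mono sup_ge1 sup_ge2)+
    from span_add[OF this] show ?thesis by simp
  qed
  then have "span ?D = UNIV" by blast
  moreover have "finite ?D" using B C by simp
  ultimately show "\<exists>B::('a \<times> 'b) set. finite B \<and> (\<forall>x. \<exists>c. x = (\<Sum>b\<in>B. c b *\<^sub>R b))"
    by (intro exI[of _ ?D] conjI allI finite_span_imp_spanning)
qed

instance prod :: (fin_dim_inner, fin_dim_inner) fin_dim_inner ..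

section \<open>Orthonormal bases and bounded linear maps\<close>

definition orth_basis :: "'a::fin_dim_inner set" where
  "orth_basis = (SOME B. finite B \<and> (\<forall>b\<in>B. norm b = 1) \<and> (\<forall>x. (\<Sum>b\<in>B. (x \<bullet> b) *\<^sub>R b) = x))"

text \<open>Gram-Schmidt applied to a finite spanning set. Sums over the resulting set replace sums
  over a standard basis; in dimension zero unit length forces it to be empty.\<close>

lemma orth_basis_aux:
  "\<exists>B::'a::fin_dim_inner set. finite B \<and> (\<forall>b\<in>B. norm b = 1) \<and> (\<forall>x. (\<Sum>b\<in>B. (x \<bullet> b) *\<^sub>R b) = x)"
proof -
  obtain B :: "'a set" where B: "finite B" "span B = UNIV"
    using fin_dim_vector_finite_span by blast
  obtain C :: "'a set" where C: "finite C" "span C = UNIV" "pairwise orthogonal C"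
    using basis_orthogonal[OF B(1)] B(2) by auto
  \<comment> \<open>The orthogonal set may contain 0, which cannot be normalised.\<close>
  let ?D = "(\<lambda>c. c /\<^sub>R norm c) ` (C - {0})"
  have fin: "finite ?D" using C by simp
  have nrm: "norm d = 1" if "d \<in> ?D" for d
  proof -
    obtain c where "c \<noteq> 0" "d = c /\<^sub>R norm c" using \<open>d \<in> ?D\<close> by auto
    then show ?thesis by simp
  qed
  have orth: "pairwise orthogonal ?D"
    using C(3) unfolding pairwise_def by (fastforce simp: orthogonal_def)
  have "c \<in> span ?D" if "c \<in> C" for c
  proof (cases "c = 0")
    case False
    then have "c = norm c *\<^sub>R (c /\<^sub>R norm c)" by simp
    then show ?thesis
      using that False by (metis (no_types, lifting) DiffI image_eqI singletonD span_base span_scale)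
  qed (simp add: span_zero)
  then have "span C \<subseteq> span ?D" by (intro span_minimal subspace_span subsetI)
  then have "span ?D = UNIV" using C(2) by (simp add: top.extremum_uniqueI)
  then have "(\<Sum>d\<in>?D. (x \<bullet> d) *\<^sub>R d) = x" for x
    using orthonormal_basis_expand[OF orth nrm _ fin] by blast
  with fin nrm show ?thesis by blast
qed

lemma finite_orth_basis [simp]: "finite orth_basis"
  and norm_orth_basis: "b \<in> orth_basis \<Longrightarrow> norm b = 1"
  and orth_basis_expand: "(\<Sum>b\<in>orth_basis. (x \<bullet> b) *\<^sub>R b) = x"
  using someI_ex[OF orth_basis_aux, folded orth_basis_def] by auto

lemma linear_orth_basis_expand:
  fixes f :: "'a::fin_dim_inner \<Rightarrow> 'b::real_vector"
  assumes "linear f"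
  shows "f x = (\<Sum>b\<in>orth_basis. (x \<bullet> b) *\<^sub>R f b)"
  using assms orth_basis_expand[of x] by (metis (no_types, lifting) linear_scale linear_sum sum.cong)

text \<open>Each coordinate of \<open>x\<close> is at most \<open>norm x\<close>, so bounds in
  finitely many directions control the operator norm. In the differentiation under the integral sign
  this upgrades directionwise estimates to estimates uniform in the direction.\<close>

lemma norm_linear_le_orth_basis:
  fixes f :: "'a::fin_dim_inner \<Rightarrow> 'b::real_normed_vector"
  assumes "linear f" and "\<And>b. b \<in> orth_basis \<Longrightarrow> norm (f b) \<le> C"
  shows "norm (f x) \<le> norm x * (real (card (orth_basis :: 'a set)) * C)"
proof -
  have "norm (f x) \<le> (\<Sum>b\<in>orth_basis. norm ((x \<bullet> b) *\<^sub>R f b))"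
    by (subst linear_orth_basis_expand[OF assms(1)]) (rule norm_sum)
  also have "\<dots> \<le> (\<Sum>b\<in>(orth_basis :: 'a set). norm x * C)"
  proof (rule sum_mono)
    fix b :: 'a assume b: "b \<in> orth_basis"
    have "\<bar>x \<bullet> b\<bar> \<le> norm x"
      using Cauchy_Schwarz_ineq2[of x b] norm_orth_basis[OF b] by simp
    then show "norm ((x \<bullet> b) *\<^sub>R f b) \<le> norm x * C"
      using assms(2)[OF b] by (simp add: mult_mono)
  qed
  also have "\<dots> = norm x * (real (card (orth_basis :: 'a set)) * C)" by simp
  finally show ?thesis .
qed

lemma linear_imp_bounded_linear:
  fixes f :: "'a::fin_dim_inner \<Rightarrow> 'b::real_normed_vector"
  assumes "linear f"
  shows "bounded_linear f"
proof -
  let ?C = "\<Sum>b\<in>orth_basis. norm (f b)"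
  have "norm (f b) \<le> ?C" if "b \<in> orth_basis" for b
    using that by (intro member_le_sum) auto
  from norm_linear_le_orth_basis[OF assms this] show ?thesis
    using assms by (intro bounded_linear_intro) (auto simp: linear_add linear_scale)
qed

section \<open>Coordinates and separation by linear functionals\<close>

lemma fin_dim_coordinates:
  obtains B :: "'v::fin_dim_vector set" and c where "finite B" "\<And>b. linear (c b)"
    and "\<And>x. (\<Sum>b\<in>B. c b x *\<^sub>R b) = x"
proof -
  obtain B :: "'v set" where B: "finite B" "independent B" "span B = UNIV"
    using fin_dim_vector_basis by blast
  show thesis
  proof (rule that[of B "\<lambda>b x. representation B x b"])
    show "finite B" by (rule B(1))
    show "linear (\<lambda>x. representation B x b)" for b
      using B by (intro linearI) (simp_all add: representation_add representation_scale)
    show "(\<Sum>b\<in>B. representation B x b *\<^sub>R b) = x" for x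
      using B by (intro sum_representation_eq) auto
  qed
qed

lemma linear_functionals_separate:
  fixes x y :: "'v::fin_dim_vector"
  assumes "\<And>l :: 'v \<Rightarrow> real. linear l \<Longrightarrow> l x = l y"
  shows "x = y"
proof -
  obtain B :: "'v set" and c where c: "\<And>b. linear (c b)" "\<And>x. (\<Sum>b\<in>B. c b x *\<^sub>R b) = x"
    by (rule fin_dim_coordinates) blast
  have "(\<Sum>b\<in>B. c b x *\<^sub>R b) = (\<Sum>b\<in>B. c b y *\<^sub>R b)" using assms[OF c(1)] by simp
  then show ?thesis by (simp add: c(2))
qed

text \<open>Induction on the independent set: a functional in \<open>S\<close> is corrected so that
  it vanishes on the old vectors and equals 1 on the new one; the old functionals are then corrected
  by multiples of it.\<close>

lemma separating_functionals_dual_family: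
  fixes S :: "('v::real_vector \<Rightarrow> real) set"
  assumes lin: "\<And>s. s \<in> S \<Longrightarrow> linear s"
    and zero: "(\<lambda>x. 0) \<in> S" and add: "\<And>s t. s \<in> S \<Longrightarrow> t \<in> S \<Longrightarrow> (\<lambda>x. s x + t x) \<in> S"
    and scale: "\<And>k s. s \<in> S \<Longrightarrow> (\<lambda>x. k * s x) \<in> S"
    and sep: "\<And>x. x \<noteq> 0 \<Longrightarrow> \<exists>s\<in>S. s x \<noteq> 0"
    and "finite C" "independent C"
  shows "\<exists>d. \<forall>c\<in>C. d c \<in> S \<and> (\<forall>c'\<in>C. d c c' = (if c' = c then 1 else 0))"
  using assms(6,7)
proof (induction C rule: finite_induct)
  case empty
  then show ?case by simp
next
  case (insert b C)
  have "independent C" and b: "b \<notin> span C"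
    using insert.hyps(2) insert.prems by (auto simp: independent_insert)
  with insert.IH obtain d where d: "\<And>c. c \<in> C \<Longrightarrow> d c \<in> S"
      "\<And>c c'. c \<in> C \<Longrightarrow> c' \<in> C \<Longrightarrow> d c c' = (if c' = c then 1 else 0)"
    by blast
  have sum: "(\<lambda>x. \<Sum>c\<in>C. k c * d c x) \<in> S" for k
  proof -
    have "(\<lambda>x. \<Sum>c\<in>C'. k c * d c x) \<in> S" if "C' \<subseteq> C" for C'
      using finite_subset[OF that \<open>finite C\<close>] that
      by (induction C' rule: finite_induct) (auto intro!: zero add scale d(1))
    then show ?thesis by blast
  qed
  \<comment> \<open>The component of \<open>b\<close> on which all functionals \<open>d c\<close>
    vanish; it is nonzero because \<open>b\<close> lies outside the span of
    \<open>C\<close>.\<close>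
  define w where "w = b - (\<Sum>c\<in>C. d c b *\<^sub>R c)"
  have "(\<Sum>c\<in>C. d c b *\<^sub>R c) \<in> span C" by (intro span_sum span_scale span_base)
  with b have "w \<noteq> 0" by (auto simp: w_def)
  then obtain s where s: "s \<in> S" "s w \<noteq> 0" using sep by blast
  \<comment> \<open>The sum cancels the values of \<open>s\<close> on \<open>C\<close>; at
    \<open>b\<close> the parenthesis equals \<open>s w\<close>, whence the normalising
    factor.\<close>
  define t where "t = (\<lambda>x. inverse (s w) * (s x + (\<Sum>c\<in>C. - s c * d c x)))"
  have t: "t \<in> S" unfolding t_def by (intro scale add s(1) sum)
  have sw: "s w = s b + (\<Sum>c\<in>C. - s c * d c b)"
    using lin[OF s(1)] by (simp add: w_def linear_diff linear_sum linear_scale sum_negf mult.commute)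
  have tb: "t b = 1" using s(2) unfolding t_def sw[symmetric] by simp
  have tc: "t c = 0" if "c \<in> C" for c
  proof -
    have "(\<Sum>c'\<in>C. - s c' * d c' c) = (\<Sum>c'\<in>C. if c' = c then - s c else 0)"
      by (rule sum.cong) (auto simp: d(2) that)
    then show ?thesis using that \<open>finite C\<close> by (simp add: t_def)
  qed
  define d' where "d' c = (if c = b then t else (\<lambda>x. d c x + - d c b * t x))" for c
  have "d' c \<in> S \<and> (\<forall>c'\<in>insert b C. d' c c' = (if c' = c then 1 else 0))" if "c \<in> insert b C" for c
  proof (cases "c = b")
    case True
    then show ?thesis using t tb tc insert.hyps(2) by (auto simp: d'_def)
  next
    case False
    with that have c: "c \<in> C" by simp
    have "(\<lambda>x. d c x + - d c b * t x) \<in> S" by (intro add scale d(1) c t)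
    then show ?thesis using False c tb tc d(2) insert.hyps(2) by (auto simp: d'_def)
  qed
  then show ?case by blast
qed

text \<open>The dual family of a basis already lies in \<open>S\<close>, so a subspace of the dual
  that separates points is the whole dual. It is applied to the differentials at the unit of all
  smooth functions.\<close>

lemma separating_functionals:
  fixes S :: "('v::fin_dim_vector \<Rightarrow> real) set"
  assumes lin: "\<And>s. s \<in> S \<Longrightarrow> linear s"
    and zero: "(\<lambda>x. 0) \<in> S" and add: "\<And>s t. s \<in> S \<Longrightarrow> t \<in> S \<Longrightarrow> (\<lambda>x. s x + t x) \<in> S"
    and scale: "\<And>k s. s \<in> S \<Longrightarrow> (\<lambda>x. k * s x) \<in> S"
    and sep: "\<And>x. x \<noteq> 0 \<Longrightarrow> \<exists>s\<in>S. s x \<noteq> 0"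
    and l: "linear l"
  shows "l \<in> S"
proof -
  obtain B :: "'v set" where B: "finite B" "independent B" "span B = UNIV"
    using fin_dim_vector_basis by blast
  have "\<exists>d. \<forall>c\<in>B. d c \<in> S \<and> (\<forall>c'\<in>B. d c c' = (if c' = c then 1 else 0))"
    by (rule separating_functionals_dual_family[OF lin zero add scale sep B(1,2)])
  then obtain d where d: "\<And>c. c \<in> B \<Longrightarrow> d c \<in> S"
      "\<And>c c'. c \<in> B \<Longrightarrow> c' \<in> B \<Longrightarrow> d c c' = (if c' = c then 1 else 0)"
    by blast
  have sum: "(\<lambda>x. \<Sum>c\<in>C. l c * d c x) \<in> S" if "C \<subseteq> B" for C
    using finite_subset[OF that B(1)] that
    by (induction C rule: finite_induct) (auto intro!: zero add scale d(1))
  have "l = (\<lambda>x. \<Sum>c\<in>B. l c * d c x)"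
  proof
    fix x
    have "linear (\<lambda>x. \<Sum>c\<in>B. l c * d c x)" by (rule lin[OF sum[OF subset_refl]])
    moreover have "l b = (\<Sum>c\<in>B. l c * d c b)" if b: "b \<in> B" for b
    proof -
      have "(\<Sum>c\<in>B. l c * d c b) = (\<Sum>c\<in>B. if c = b then l b else 0)"
        by (rule sum.cong) (auto simp: d(2) b)
      then show ?thesis using b B(1) by simp
    qed
    ultimately show "l x = (\<Sum>c\<in>B. l c * d c x)"
      using linear_eq_on_span[OF l] B(3) by blast
  qed
  with sum[OF subset_refl] show ?thesis by simp
qed

section \<open>Smooth functions on open sets\<close>

lemma Ck_on_subset: "Ck_on k T f \<Longrightarrow> S \<subseteq> T \<Longrightarrow> Ck_on k S f"
  by (induction k arbitrary: f) (auto intro: continuous_on_subset)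

lemma Ck_on_has_derivative:
  "Ck_on (Suc k) S f \<Longrightarrow> x \<in> S \<Longrightarrow> (f has_derivative frechet_derivative f (at x)) (at x)"
  by (simp add: frechet_derivative_works)

lemma Ck_on_SucD: "Ck_on (Suc k) S f \<Longrightarrow> Ck_on k S f"
proof (induction k arbitrary: f)
  case 0
  then show ?case
    by (auto intro!: continuous_at_imp_continuous_on differentiable_imp_continuous_within)
qed auto

text \<open>Openness allows values off \<open>S\<close> to be ignored although the derivatives are
  taken in the full space.\<close>

lemma Ck_on_cong:
  assumes "open S" and "\<And>x. x \<in> S \<Longrightarrow> f x = g x" and "Ck_on k S f"
  shows "Ck_on k S g"
  using assms(2,3)
proof (induction k arbitrary: f g)
  case 0
  then show ?case by (simp cong: continuous_on_cong)
next
  case (Suc k)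
  have d: "(g has_derivative frechet_derivative f (at x)) (at x)" if "x \<in> S" for x
    using Ck_on_has_derivative[OF Suc.prems(2) that] \<open>open S\<close> that Suc.prems(1)
    by (rule has_derivative_transform_within_open)
  show ?case
  proof (simp, intro conjI ballI allI)
    show "g differentiable at x" if "x \<in> S" for x using d[OF that] differentiable_def by blast
    fix v
    show "Ck_on k S (\<lambda>x. frechet_derivative g (at x) v)"
      by (rule Suc.IH[where f = "\<lambda>x. frechet_derivative f (at x) v"])
        (use Suc.prems(2) in \<open>auto simp: frechet_derivative_at[OF d]\<close>)
  qed
qed

text \<open>Drives the inductions on the order that follow: an explicitly computed derivative takes
  the place of the chosen \<open>frechet_derivative\<close>.\<close>

lemma Ck_on_SucI:
  assumes "open S" and "\<And>x. x \<in> S \<Longrightarrow> (f has_derivative f' x) (at x)"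
    and "\<And>v. Ck_on k S (\<lambda>x. f' x v)"
  shows "Ck_on (Suc k) S f"
proof (simp, intro conjI ballI allI)
  show "f differentiable at x" if "x \<in> S" for x using assms(2)[OF that] differentiable_def by blast
  show "Ck_on k S (\<lambda>x. frechet_derivative f (at x) v)" for v
    by (rule Ck_on_cong[OF assms(1) _ assms(3)[of v]]) (simp add: frechet_derivative_at[OF assms(2)])
qed

lemma Ck_on_local:
  assumes "\<And>x. x \<in> S \<Longrightarrow> \<exists>T. open T \<and> x \<in> T \<and> Ck_on k T f"
  shows "Ck_on k S f"
  using assms
proof (induction k arbitrary: f)
  case 0
  then show ?case
    by simp (metis continuous_at_imp_continuous_on continuous_on_eq_continuous_at)
next
  case (Suc k)
  then show ?case by simp metis
qed

lemma Ck_on_const: "Ck_on k S (\<lambda>x. c)"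
  by (induction k arbitrary: c) auto

lemma Ck_on_bounded_linear_compose:
  assumes "open S" "bounded_linear L" "Ck_on k S f"
  shows "Ck_on k S (\<lambda>x. L (f x))"
  using assms(3)
proof (induction k arbitrary: f)
  case 0
  then show ?case
    using bounded_linear.continuous_on[OF assms(2)] by simp
next
  case (Suc k)
  show ?case
    by (rule Ck_on_SucI[OF assms(1)
          bounded_linear.has_derivative[OF assms(2) Ck_on_has_derivative[OF Suc.prems]]])
      (use Suc in auto)
qed

lemma Ck_on_ident: "Ck_on k S (\<lambda>x. x)"
  by (cases k) (auto intro: Ck_on_const continuous_on_id)

lemma Ck_on_add:
  assumes "open S" "Ck_on k S f" "Ck_on k S g"
  shows "Ck_on k S (\<lambda>x. f x + g x)"
  using assms(2,3)
proof (induction k arbitrary: f g)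
  case 0
  then show ?case by (simp add: continuous_on_add)
next
  case (Suc k)
  show ?case
    by (rule Ck_on_SucI[OF assms(1)
          has_derivative_add[OF Ck_on_has_derivative[OF Suc.prems(1)] Ck_on_has_derivative[OF Suc.prems(2)]]])
      (use Suc in auto)
qed

lemma Ck_on_sum:
  assumes "open S" "\<And>i. i \<in> I \<Longrightarrow> Ck_on k S (f i)"
  shows "Ck_on k S (\<lambda>x. \<Sum>i\<in>I. f i x)"
  using assms(2)
  by (induction I rule: infinite_finite_induct) (auto intro: Ck_on_const Ck_on_add[OF assms(1)])

lemma Ck_on_bilinear:
  assumes "open S" "bounded_bilinear m" "Ck_on k S f" "Ck_on k S g"
  shows "Ck_on k S (\<lambda>x. m (f x) (g x))"
  using assms(3,4)
proof (induction k arbitrary: f g)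
  case 0
  then show ?case using bounded_bilinear.continuous_on[OF assms(2)] by simp
next
  case (Suc k)
  show ?case
    by (rule Ck_on_SucI[OF assms(1) bounded_bilinear.FDERIV[OF assms(2)
            Ck_on_has_derivative[OF Suc.prems(1)] Ck_on_has_derivative[OF Suc.prems(2)]]])
      (use Suc.prems Ck_on_SucD[OF Suc.prems(1)] Ck_on_SucD[OF Suc.prems(2)]
        in \<open>auto intro!: Ck_on_add[OF assms(1)] Suc.IH\<close>)
qed

text \<open>In the chain rule both the linear map and its argument vary with \<open>x\<close>.
  Expanding the argument in an orthonormal basis turns the derivative into a finite sum of products,
  to which the induction hypothesis applies; hence the class of the intermediate space.\<close>

lemma Ck_on_compose:
  fixes f :: "'a::real_normed_vector \<Rightarrow> 'b::fin_dim_inner" and g :: "'b \<Rightarrow> 'c::real_normed_vector"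
  assumes "open S" "f ` S \<subseteq> T" "Ck_on k S f" "Ck_on k T g"
  shows "Ck_on k S (\<lambda>x. g (f x))"
  using assms(3,4)
proof (induction k arbitrary: g)
  case 0
  then show ?case using assms(2) by (auto intro: continuous_on_compose2)
next
  case (Suc k)
  have d: "((\<lambda>x. g (f x)) has_derivative
     (\<lambda>v. frechet_derivative g (at (f x)) (frechet_derivative f (at x) v))) (at x)" if "x \<in> S" for x
    using has_derivative_compose[OF Ck_on_has_derivative[OF Suc.prems(1) that]
        Ck_on_has_derivative[OF Suc.prems(2), of "f x"]] assms(2) that by blast
  show ?case
  proof (rule Ck_on_SucI[OF assms(1) d])
    fix v
    have "Ck_on k S (\<lambda>x. \<Sum>b\<in>orth_basis.
        (frechet_derivative f (at x) v \<bullet> b) *\<^sub>R frechet_derivative g (at (f x)) b)"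
    proof (rule Ck_on_sum[OF assms(1)], rule Ck_on_bilinear[OF assms(1) bounded_bilinear_scaleR])
      fix b :: 'b
      show "Ck_on k S (\<lambda>x. frechet_derivative f (at x) v \<bullet> b)"
        using Suc.prems(1) by (auto intro: Ck_on_bounded_linear_compose[OF assms(1) bounded_linear_inner_left])
      show "Ck_on k S (\<lambda>x. frechet_derivative g (at (f x)) b)"
        using Suc.prems Ck_on_SucD by (auto intro!: Suc.IH)
    qed
    then show "Ck_on k S (\<lambda>x. frechet_derivative g (at (f x)) (frechet_derivative f (at x) v))"
    proof (rule Ck_on_cong[OF assms(1), rotated])
      fix x assume "x \<in> S"
      then have "linear (frechet_derivative g (at (f x)))"
        using Ck_on_has_derivative[OF Suc.prems(2), of "f x"] assms(2)
        by (meson has_derivative_linear image_subset_iff)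
      from linear_orth_basis_expand[OF this, of "frechet_derivative f (at x) v"]
      show "(\<Sum>b\<in>orth_basis. (frechet_derivative f (at x) v \<bullet> b) *\<^sub>R frechet_derivative g (at (f x)) b) =
        frechet_derivative g (at (f x)) (frechet_derivative f (at x) v)" by simp
    qed
  qed
qed

section \<open>Closure properties of smooth functions\<close>

lemma smooth_on_subset: "smooth_on T f \<Longrightarrow> S \<subseteq> T \<Longrightarrow> smooth_on S f"
  using Ck_on_subset unfolding smooth_on_def by blast

lemma smooth_on_cong:
  "open S \<Longrightarrow> (\<And>x. x \<in> S \<Longrightarrow> f x = g x) \<Longrightarrow> smooth_on S f \<Longrightarrow> smooth_on S g"
  using Ck_on_cong unfolding smooth_on_def by blast

lemma smooth_on_local:
  "(\<And>x. x \<in> S \<Longrightarrow> \<exists>T. open T \<and> x \<in> T \<and> smooth_on T f) \<Longrightarrow> smooth_on S f"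
  unfolding smooth_on_def using Ck_on_local by metis

lemma smooth_on_const: "smooth_on S (\<lambda>x. c)"
  by (simp add: smooth_on_def Ck_on_const)

lemma smooth_on_ident: "smooth_on S (\<lambda>x. x)"
  by (simp add: smooth_on_def Ck_on_ident)

lemma smooth_on_bounded_linear:
  "open S \<Longrightarrow> bounded_linear L \<Longrightarrow> smooth_on S f \<Longrightarrow> smooth_on S (\<lambda>x. L (f x))"
  by (simp add: smooth_on_def Ck_on_bounded_linear_compose)

lemma smooth_on_add:
  "open S \<Longrightarrow> smooth_on S f \<Longrightarrow> smooth_on S g \<Longrightarrow> smooth_on S (\<lambda>x. f x + g x)"
  by (simp add: smooth_on_def Ck_on_add)

lemma smooth_on_sum:
  "open S \<Longrightarrow> (\<And>i. i \<in> I \<Longrightarrow> smooth_on S (f i)) \<Longrightarrow> smooth_on S (\<lambda>x. \<Sum>i\<in>I. f i x)"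
  by (simp add: smooth_on_def Ck_on_sum)

lemma smooth_on_bilinear:
  "open S \<Longrightarrow> bounded_bilinear m \<Longrightarrow> smooth_on S f \<Longrightarrow> smooth_on S g \<Longrightarrow>
   smooth_on S (\<lambda>x. m (f x) (g x))"
  by (simp add: smooth_on_def Ck_on_bilinear)

lemma smooth_on_mult:
  fixes f g :: "'a::real_normed_vector \<Rightarrow> real"
  shows "open S \<Longrightarrow> smooth_on S f \<Longrightarrow> smooth_on S g \<Longrightarrow> smooth_on S (\<lambda>x. f x * g x)"
  by (rule smooth_on_bilinear[OF _ bounded_bilinear_mult])

lemma smooth_on_diff:
  assumes "open S" "smooth_on S f" "smooth_on S g"
  shows "smooth_on S (\<lambda>x. f x - g x)"
  using smooth_on_add[OF assms(1,2) smooth_on_bounded_linear[OF assms(1)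
        bounded_linear_minus[OF bounded_linear_ident] assms(3)]] by simp

lemma smooth_on_compose:
  fixes f :: "'a::real_normed_vector \<Rightarrow> 'b::fin_dim_inner"
  shows "open S \<Longrightarrow> f ` S \<subseteq> T \<Longrightarrow> smooth_on S f \<Longrightarrow> smooth_on T g \<Longrightarrow> smooth_on S (\<lambda>x. g (f x))"
  by (simp add: smooth_on_def Ck_on_compose)

lemma smooth_on_Pair:
  assumes "open S" "smooth_on S f" "smooth_on S g"
  shows "smooth_on S (\<lambda>x. (f x, g x))"
proof -
  have "bounded_linear (\<lambda>y. (y, 0))" "bounded_linear (\<lambda>y. (0, y))"
    by (intro bounded_linear_Pair bounded_linear_ident bounded_linear_zero)+
  from smooth_on_add[OF assms(1) smooth_on_bounded_linear[OF assms(1) this(1) assms(2)]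
      smooth_on_bounded_linear[OF assms(1) this(2) assms(3)]]
  show ?thesis by simp
qed

lemma smooth_on_frechet_derivative:
  "smooth_on S f \<Longrightarrow> smooth_on S (\<lambda>x. frechet_derivative f (at x) v)"
  unfolding smooth_on_def by (metis Ck_on.simps(2))

lemma smooth_on_has_derivative:
  "smooth_on S f \<Longrightarrow> x \<in> S \<Longrightarrow> (f has_derivative frechet_derivative f (at x)) (at x)"
  unfolding smooth_on_def using Ck_on_has_derivative by blast

lemma smooth_on_continuous_on: "smooth_on S f \<Longrightarrow> continuous_on S f"
  unfolding smooth_on_def by (metis Ck_on.simps(1))

text \<open>The derivative is minus the square of the function itself, so the order can be raised
  step by step.\<close>

lemma smooth_on_real_inverse: "smooth_on (- {0}) (inverse :: real \<Rightarrow> real)"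
  unfolding smooth_on_def
proof
  fix k
  show "Ck_on k (- {0}) (inverse :: real \<Rightarrow> real)"
  proof (induction k)
    case 0
    then show ?case by (simp add: continuous_on_inverse)
  next
    case (Suc k)
    show ?case
      by (rule Ck_on_SucI[OF _ has_derivative_inverse'])
        (auto intro!: Ck_on_bounded_linear_compose[where L = uminus] bounded_linear_minus bounded_linear_ident
          Ck_on_bilinear[OF _ bounded_bilinear_mult] Suc Ck_on_const)
  qed
qed

subsection \<open>Hadamard's lemma\<close>

lemma ball_segment:
  fixes c :: "'a::real_normed_vector"
  assumes "y \<in> ball c e" "t \<in> {0..1}"
  shows "c + t *\<^sub>R (y - c) \<in> ball c e"
proof -
  have "norm (t *\<^sub>R (y - c)) \<le> norm (y - c)"
    using assms(2) by (simp add: mult_left_le_one_le)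
  then show ?thesis using assms(1) by (simp add: dist_norm norm_minus_commute)
qed

text \<open>The weight \<open>t ^ n\<close> is carried along because every differentiation of the
  integrand in \<open>y\<close> brings out one more factor \<open>t\<close>.\<close>

lemma continuous_on_segment_weight:
  fixes f :: "'a::real_normed_vector \<Rightarrow> real"
  assumes "continuous_on (ball c e) f"
  shows "continuous_on (ball c e \<times> {0..1}) (\<lambda>(y, t). t ^ n * f (c + t *\<^sub>R (y - c)))"
proof -
  have "continuous_on (ball c e \<times> {0..1}) (\<lambda>p. f (c + snd p *\<^sub>R (fst p - c)))"
  proof (rule continuous_on_compose2[OF assms])
    show "continuous_on (ball c e \<times> {0..1}) (\<lambda>p. c + snd p *\<^sub>R (fst p - c))"
      by (intro continuous_intros)
    show "(\<lambda>p. c + snd p *\<^sub>R (fst p - c)) ` (ball c e \<times> {0..1}) \<subseteq> ball c e"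
      using ball_segment[where 'a = 'a] by (auto simp del: mem_ball atLeastAtMost_iff)
  qed
  then have "continuous_on (ball c e \<times> {0..1}) (\<lambda>p. snd p ^ n * f (c + snd p *\<^sub>R (fst p - c)))"
    by (intro continuous_intros)
  then show ?thesis by (simp add: case_prod_unfold)
qed

lemma continuous_on_segment_weight':
  fixes f :: "'a::real_normed_vector \<Rightarrow> real"
  assumes "continuous_on (ball c e) f" "y \<in> ball c e"
  shows "continuous_on {0..1} (\<lambda>t. t ^ n * f (c + t *\<^sub>R (y - c)))"
proof -
  have "continuous_on {0..1} (\<lambda>t. (\<lambda>(y, t). t ^ n * f (c + t *\<^sub>R (y - c))) (y, t))"
    by (rule continuous_on_compose2[OF continuous_on_segment_weight[OF assms(1), of n]])
      (use assms(2) in \<open>auto intro!: continuous_intros\<close>)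
  then show ?thesis by simp
qed

text \<open>Differentiation under the integral sign. Compactness of the unit interval makes the
  derivatives of the integrands continuous in the base point uniformly in \<open>t\<close>; the mean
  value inequality turns this into a uniform linear approximation, which can be integrated.\<close>

lemma has_derivative_integral_segment:
  fixes f :: "'a::fin_dim_inner \<Rightarrow> real"
  assumes f: "Ck_on (Suc 0) (ball c e) f" and y: "y \<in> ball c e"
  shows "((\<lambda>y. integral {0..1} (\<lambda>t. t ^ n * f (c + t *\<^sub>R (y - c)))) has_derivative
     (\<lambda>v. integral {0..1} (\<lambda>t. t ^ Suc n * frechet_derivative f (at (c + t *\<^sub>R (y - c))) v))) (at y)"
proof -
  define g where "g y t = t ^ n * f (c + t *\<^sub>R (y - c))" for y t
  define g' where "g' y t v = t ^ Suc n * frechet_derivative f (at (c + t *\<^sub>R (y - c))) v" for y t v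
  define L where "L v = integral {0..1} (\<lambda>t. g' y t v)" for v
  have contf: "continuous_on (ball c e) f"
    using Ck_on_SucD[OF f] by simp
  have contdf: "continuous_on (ball c e) (\<lambda>x. frechet_derivative f (at x) v)" for v
    using f by simp
  have df: "(f has_derivative frechet_derivative f (at x)) (at x)" if "x \<in> ball c e" for x
    using Ck_on_has_derivative[OF f that] .
  have lin: "linear (frechet_derivative f (at (c + t *\<^sub>R (x - c))))"
    if "x \<in> ball c e" "t \<in> {0..1}" for x t
    using df[OF ball_segment[OF that]] has_derivative_linear by blast
  have dg: "((\<lambda>x. g x t) has_derivative g' x t) (at x)" if x: "x \<in> ball c e" "t \<in> {0..1}" for x t
  proof -
    have "((\<lambda>x. c + t *\<^sub>R (x - c)) has_derivative (\<lambda>v. t *\<^sub>R v)) (at x)"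
      by (auto intro!: derivative_eq_intros)
    from has_derivative_compose[OF this df[OF ball_segment[OF x]]]
    have "((\<lambda>x. f (c + t *\<^sub>R (x - c))) has_derivative
        (\<lambda>v. t * frechet_derivative f (at (c + t *\<^sub>R (x - c))) v)) (at x)"
      by (simp add: linear_scale[OF lin[OF x]])
    from has_derivative_mult_right[OF this, of "t ^ n"] show ?thesis
      unfolding g_def g'_def by (simp add: ac_simps)
  qed
  have contg: "continuous_on {0..1} (g x)" if "x \<in> ball c e" for x
    unfolding g_def by (rule continuous_on_segment_weight'[OF contf that])
  have contg': "continuous_on {0..1} (\<lambda>t. g' x t v)" if "x \<in> ball c e" for x v
    unfolding g'_def by (rule continuous_on_segment_weight'[OF contdf that])
  have ling': "linear (g' x t)" if "x \<in> ball c e" "t \<in> {0..1}" for x t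
    using dg[OF that] has_derivative_linear by blast
  have "linear L"
  proof
    fix v w :: 'a and a :: real
    have "L (v + w) = integral {0..1} (\<lambda>t. g' y t v + g' y t w)"
      unfolding L_def by (rule integral_cong) (simp add: linear_add[OF ling'[OF y]])
    then show "L (v + w) = L v + L w"
      unfolding L_def using contg'[OF y] by (simp add: integral_add integrable_continuous_interval)
    have "L (a *\<^sub>R v) = integral {0..1} (\<lambda>t. a * g' y t v)"
      unfolding L_def by (rule integral_cong) (simp add: linear_scale[OF ling'[OF y]])
    then show "L (a *\<^sub>R v) = a *\<^sub>R L v"
      unfolding L_def by simp
  qed
  then have bl: "bounded_linear L" by (rule linear_imp_bounded_linear)
  have "((\<lambda>y. integral {0..1} (g y)) has_derivative L) (at y)"
    unfolding has_derivative_at_alt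
  proof (intro conjI allI impI bl)
    fix \<epsilon> :: real assume "\<epsilon> > 0"
    define N where "N = real (card (orth_basis :: 'a set))"
    \<comment> \<open>Each of the \<open>N\<close> basis directions is allowed an error
      \<open>\<eta>\<close>; the added 1 keeps \<open>\<eta>\<close> positive in dimension
      zero.\<close>
    define \<eta> where "\<eta> = \<epsilon> / (N + 1)"
    have "N \<ge> 0" by (simp add: N_def)
    with \<open>\<epsilon> > 0\<close> have "\<eta> > 0" and N\<eta>: "N * \<eta> \<le> \<epsilon>"
      by (auto simp: \<eta>_def field_simps)
    \<comment> \<open>A tube argument over the compact interval, one direction at a time; only the
      neighbourhoods of the finitely many basis directions are intersected afterwards.\<close>
    have "\<forall>b. \<exists>X. y \<in> X \<and> open X \<and> (\<forall>x\<in>X \<inter> ball c e. \<forall>t\<in>{0..1}. dist (g' x t b) (g' y t b) \<le> \<eta>)"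
    proof
      fix b
      obtain X where "y \<in> X" "open X"
        "\<forall>x\<in>X \<inter> ball c e. \<forall>t\<in>{0..1}. dist ((\<lambda>(x, t). g' x t b) (x, t)) ((\<lambda>(x, t). g' x t b) (y, t)) \<le> \<eta>"
        unfolding g'_def
        by (rule continuous_on_prod_compactE[OF continuous_on_segment_weight[OF contdf[of b], of "Suc n"]
              compact_Icc y \<open>\<eta> > 0\<close>])
      then show "\<exists>X. y \<in> X \<and> open X \<and> (\<forall>x\<in>X \<inter> ball c e. \<forall>t\<in>{0..1}. dist (g' x t b) (g' y t b) \<le> \<eta>)"
        by (intro exI[of _ X]) simp
    qed
    then obtain X where X': "\<forall>b. y \<in> X b \<and> open (X b) \<and>
        (\<forall>x\<in>X b \<inter> ball c e. \<forall>t\<in>{0..1}. dist (g' x t b) (g' y t b) \<le> \<eta>)"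
      by (rule exE[OF choice])
    have X: "y \<in> X b" "open (X b)"
        "x \<in> X b \<Longrightarrow> x \<in> ball c e \<Longrightarrow> t \<in> {0..1} \<Longrightarrow> dist (g' x t b) (g' y t b) \<le> \<eta>" for b x t
      using X' by simp_all
    have "open ((\<Inter>b\<in>orth_basis. X b) \<inter> ball c e)"
      by (intro open_Int open_INT finite_orth_basis ballI X(2) open_ball)
    moreover have "y \<in> (\<Inter>b\<in>orth_basis. X b) \<inter> ball c e" using X(1) y by auto
    ultimately obtain d where d: "d > 0" "ball y d \<subseteq> (\<Inter>b\<in>orth_basis. X b) \<inter> ball c e"
      by (meson openE)
    show "\<exists>d>0. \<forall>z. norm (z - y) < d \<longrightarrow>
      norm (integral {0..1} (g z) - integral {0..1} (g y) - L (z - y)) \<le> \<epsilon> * norm (z - y)"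
    proof (intro exI[of _ d] conjI allI impI d(1))
      fix z assume "norm (z - y) < d"
      then have z: "z \<in> ball y d" by (simp add: dist_norm norm_minus_commute)
      then have zc: "z \<in> ball c e" using d by blast
      have bound: "norm (g z t - g y t - g' y t (z - y)) \<le> \<epsilon> * norm (z - y)" if t: "t \<in> {0..1}" for t
      proof -
        \<comment> \<open>Mean value inequality for the map minus its linear part at
          \<open>y\<close>; the derivative of this difference is small in operator norm on the
          ball.\<close>
        have "norm (g z t - g y t - g' y t (z - y)) \<le> norm (z - y) * (N * \<eta>)"
        proof (rule differentiable_bound_linearization[where S = "ball y d" and f = "\<lambda>x. g x t"])
          show "y + s *\<^sub>R (z - y) \<in> ball y d" if "s \<in> {0..1}" for s
            using ball_segment[OF z that] .
          show "((\<lambda>x. g x t) has_derivative g' x t) (at x within ball y d)" if "x \<in> ball y d" for x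
            using dg[of x t] t d that has_derivative_at_withinI by blast
          show "onorm (g' x t - g' y t) \<le> N * \<eta>" if x: "x \<in> ball y d" for x
          proof (rule onorm_bound)
            show "0 \<le> N * \<eta>" using \<open>N \<ge> 0\<close> \<open>\<eta> > 0\<close> by simp
            fix v
            have xc: "x \<in> ball c e" using x d by blast
            have "linear (\<lambda>v. g' x t v - g' y t v)"
              by (rule linear_compose_sub[OF ling'[OF xc t] ling'[OF y t]])
            moreover have "norm (g' x t b - g' y t b) \<le> \<eta>" if "b \<in> orth_basis" for b
              using X(3)[of x b t] x d that xc t by (auto simp: dist_norm)
            ultimately show "norm ((g' x t - g' y t) v) \<le> N * \<eta> * norm v"
              using norm_linear_le_orth_basis[of "\<lambda>v. g' x t v - g' y t v" \<eta> v]
              by (simp add: N_def ac_simps)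
          qed
          show "y \<in> ball y d" using d(1) by simp
        qed
        also have "\<dots> \<le> norm (z - y) * \<epsilon>" using N\<eta> by (simp add: mult_left_mono)
        finally show ?thesis by (simp add: ac_simps)
      qed
      have int: "g z integrable_on {0..1}" "g y integrable_on {0..1}" "(\<lambda>t. g' y t (z - y)) integrable_on {0..1}"
        using contg[OF zc] contg[OF y] contg'[OF y] by (auto intro: integrable_continuous_interval)
      have "integral {0..1} (g z) - integral {0..1} (g y) - L (z - y)
          = integral {0..1} (\<lambda>t. g z t - g y t - g' y t (z - y))"
        unfolding L_def using int by (simp add: integral_diff integrable_diff)
      also have "norm \<dots> \<le> \<epsilon> * norm (z - y) * (1 - 0)"
        by (rule integral_bound)
          (use bound in \<open>auto intro!: continuous_on_diff contg[OF zc] contg[OF y] contg'[OF y]\<close>)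
      finally show "norm (integral {0..1} (g z) - integral {0..1} (g y) - L (z - y)) \<le> \<epsilon> * norm (z - y)"
        by simp
    qed
  qed
  then show ?thesis unfolding g_def g'_def L_def .
qed

text \<open>Differentiation yields an integral of the same shape with one more factor
  \<open>t\<close> and a directional derivative of \<open>f\<close>; the induction therefore keeps
  both the exponent and the function arbitrary.\<close>

lemma Ck_on_integral_segment:
  fixes f :: "'a::fin_dim_inner \<Rightarrow> real"
  assumes "Ck_on k (ball c e) f"
  shows "Ck_on k (ball c e) (\<lambda>y. integral {0..1} (\<lambda>t. t ^ n * f (c + t *\<^sub>R (y - c))))"
  using assms
proof (induction k arbitrary: f n)
  case 0
  then have "continuous_on (ball c e \<times> cbox 0 1) (\<lambda>(y, t). t ^ n * f (c + t *\<^sub>R (y - c)))"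
    using continuous_on_segment_weight[of c e f n] by simp
  from integral_continuous_on_param[OF this] show ?case by simp
next
  case (Suc k)
  have "Ck_on (Suc 0) (ball c e) f"
    using Suc.prems by (induction k) (auto dest: Ck_on_SucD simp del: Ck_on.simps)
  show ?case
    by (rule Ck_on_SucI[OF open_ball has_derivative_integral_segment[OF \<open>Ck_on (Suc 0) (ball c e) f\<close>]])
      (use Suc.prems in \<open>auto intro!: Suc.IH simp del: power_Suc\<close>)
qed

text \<open>The fundamental theorem of calculus along the segment from \<open>c\<close> to
  \<open>y\<close>, with the direction \<open>y - c\<close> expanded in the orthonormal basis. For
  \<open>y = c\<close> the integrand is constant in \<open>t\<close>, which gives the values of the
  factors at \<open>c\<close>.\<close>

lemma hadamard:
  fixes f :: "'a::fin_dim_inner \<Rightarrow> real"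
  assumes f: "smooth_on (ball c e) f"
  obtains g where "\<And>b. smooth_on (ball c e) (g b)"
    and "\<And>b. g b c = frechet_derivative f (at c) b"
    and "\<And>y. y \<in> ball c e \<Longrightarrow> f y = f c + (\<Sum>b\<in>orth_basis. ((y - c) \<bullet> b) * g b y)"
proof -
  define g where "g b y = integral {0..1} (\<lambda>t. t ^ 0 * frechet_derivative f (at (c + t *\<^sub>R (y - c))) b)"
    for b y
  show thesis
  proof (rule that[of g])
    show "smooth_on (ball c e) (g b)" for b
      using smooth_on_frechet_derivative[OF f, of b] Ck_on_integral_segment
      unfolding smooth_on_def g_def by blast
    show "g b c = frechet_derivative f (at c) b" for b
      by (simp add: g_def)
    fix y assume y: "y \<in> ball c e"
    have int: "(\<lambda>t. frechet_derivative f (at (c + t *\<^sub>R (y - c))) v) integrable_on {0..1}" for v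
      using continuous_on_segment_weight'[OF smooth_on_continuous_on[OF smooth_on_frechet_derivative[OF f]] y,
          of 0 v]
      by (auto intro: integrable_continuous_interval)
    have "((\<lambda>t. frechet_derivative f (at (c + t *\<^sub>R (y - c))) (y - c)) has_integral
        f (c + 1 *\<^sub>R (y - c)) - f (c + 0 *\<^sub>R (y - c))) {0..1}"
    proof (rule fundamental_theorem_of_calculus)
      fix t :: real assume t: "t \<in> {0..1}"
      have d: "(f has_derivative frechet_derivative f (at (c + t *\<^sub>R (y - c)))) (at (c + t *\<^sub>R (y - c)))"
        by (rule smooth_on_has_derivative[OF f ball_segment[OF y t]])
      have "((\<lambda>t. c + t *\<^sub>R (y - c)) has_derivative (\<lambda>s. s *\<^sub>R (y - c))) (at t within {0..1})"
        by (auto intro!: derivative_eq_intros)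
      from has_derivative_compose[OF this d] has_derivative_linear[OF d]
      show "((\<lambda>t. f (c + t *\<^sub>R (y - c))) has_vector_derivative
          frechet_derivative f (at (c + t *\<^sub>R (y - c))) (y - c)) (at t within {0..1})"
        by (simp add: has_vector_derivative_def linear_scale)
    qed simp
    then have "f y - f c = integral {0..1} (\<lambda>t. frechet_derivative f (at (c + t *\<^sub>R (y - c))) (y - c))"
      by (simp add: has_integral_integrable_integral)
    also have "\<dots> = integral {0..1} (\<lambda>t. \<Sum>b\<in>orth_basis.
        ((y - c) \<bullet> b) * frechet_derivative f (at (c + t *\<^sub>R (y - c))) b)"
    proof (rule integral_cong)
      fix t :: real assume t: "t \<in> {0..1}"
      show "frechet_derivative f (at (c + t *\<^sub>R (y - c))) (y - c) =
          (\<Sum>b\<in>orth_basis. ((y - c) \<bullet> b) * frechet_derivative f (at (c + t *\<^sub>R (y - c))) b)"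
        using linear_orth_basis_expand[OF has_derivative_linear[OF
              smooth_on_has_derivative[OF f ball_segment[OF y t]]], of "y - c"] by simp
    qed
    also have "\<dots> = (\<Sum>b\<in>orth_basis. ((y - c) \<bullet> b) * g b y)"
      by (subst integral_sum) (auto simp: g_def intro!: integrable_on_mult_right int)
    finally show "f y = f c + (\<Sum>b\<in>orth_basis. ((y - c) \<bullet> b) * g b y)" by simp
  qed
qed

subsection \<open>Bump functions\<close>

text \<open>The classical flat function \<open>exp (-1/t)\<close> together with its multiples by
  powers of \<open>1/t\<close>, so that derivatives of members are combinations of members.\<close>

definition flat_exp :: "nat \<Rightarrow> real \<Rightarrow> real" where
  "flat_exp n t = (if t \<le> 0 then 0 else inverse t ^ n * exp (- inverse t))"

lemma flat_exp_tendsto_0: "(flat_exp n \<longlongrightarrow> 0) (at_right 0)"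
proof -
  have "((\<lambda>t::real. inverse t ^ n / exp (inverse t)) \<longlongrightarrow> 0) (at_right 0)"
    by (rule filterlim_compose[OF tendsto_power_div_exp_0 filterlim_inverse_at_top_right])
  moreover have "\<forall>\<^sub>F t in at_right 0. inverse t ^ n / exp (inverse t) = flat_exp n t"
    by (rule eventually_at_rightI[of 0 1]) (auto simp: flat_exp_def exp_minus divide_inverse)
  ultimately show ?thesis by (rule Lim_transform_eventually)
qed

lemma flat_exp_has_derivative:
  "(flat_exp n has_real_derivative (flat_exp (n + 2) t - n * flat_exp (n + 1) t)) (at t)"
proof (cases t "0 :: real" rule: linorder_cases)
  case less
  have "((\<lambda>t. 0) has_real_derivative 0) (at t)" by simp
  then have "(flat_exp n has_real_derivative 0) (at t)"
    by (rule has_field_derivative_transform_within_open[where S = "{..<0}"]) (use less in \<open>auto simp: flat_exp_def\<close>)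
  then show ?thesis using less by (simp add: flat_exp_def)
next
  \<comment> \<open>At 0 the difference quotient vanishes on the left and is
    \<open>flat_exp (Suc n)\<close> on the right, so the limit already computed applies.\<close>
  case equal
  have "((\<lambda>h. flat_exp n h / h) \<longlongrightarrow> 0) (at_left 0)"
    by (rule Lim_transform_eventually[OF tendsto_const])
      (auto intro!: eventually_at_leftI[of "-1"] simp: flat_exp_def)
  moreover have "((\<lambda>h. flat_exp n h / h) \<longlongrightarrow> 0) (at_right 0)"
    by (rule Lim_transform_eventually[OF flat_exp_tendsto_0[of "Suc n"]])
      (auto intro!: eventually_at_rightI[of _ 1] simp: flat_exp_def divide_inverse)
  ultimately have "((\<lambda>h. flat_exp n h / h) \<longlongrightarrow> 0) (at 0)"
    by (rule filterlim_split_at_real)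
  then show ?thesis using equal by (simp add: DERIV_def flat_exp_def)
next
  case greater
  have d: "(inverse has_real_derivative - (inverse t * inverse t)) (at t)"
    using greater by (auto intro!: derivative_eq_intros)
  have "((\<lambda>t. inverse t ^ n * exp (- inverse t)) has_real_derivative
      flat_exp (n + 2) t - n * flat_exp (n + 1) t) (at t)"
  proof (rule DERIV_cong[OF DERIV_mult[OF DERIV_power[OF d, of n] DERIV_fun_exp[OF DERIV_minus[OF d]]]])
    show "real n * (- (inverse t * inverse t) * inverse t ^ (n - Suc 0)) * exp (- inverse t) +
        exp (- inverse t) * - (- (inverse t * inverse t)) * inverse t ^ n =
        flat_exp (n + 2) t - n * flat_exp (n + 1) t"
      using greater by (cases n) (simp_all add: flat_exp_def algebra_simps)
  qed
  then show ?thesis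
    by (rule has_field_derivative_transform_within_open[where S = "{0<..}"]) (use greater in \<open>auto simp: flat_exp_def\<close>)
qed

lemma smooth_on_flat_exp: "smooth_on UNIV (flat_exp n)"
  unfolding smooth_on_def
proof
  fix k
  show "Ck_on k UNIV (flat_exp n)"
  proof (induction k arbitrary: n)
    case 0
    show ?case
      using DERIV_continuous_on[OF has_field_derivative_at_within[OF flat_exp_has_derivative]] by simp
  next
    case (Suc k)
    show ?case
    proof (rule Ck_on_SucI[OF open_UNIV flat_exp_has_derivative[unfolded has_field_derivative_def]])
      fix v
      have "Ck_on k UNIV (\<lambda>t. flat_exp (n + 2) t * v + flat_exp (n + 1) t * (- real n * v))"
        by (intro Ck_on_add Ck_on_bounded_linear_compose[OF _ bounded_linear_mult_left] Suc open_UNIV)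
      then show "Ck_on k UNIV (\<lambda>t. (flat_exp (n + 2) t - n * flat_exp (n + 1) t) * v)"
        by (simp add: algebra_simps)
    qed
  qed
qed

lemma smooth_bump:
  fixes c :: "'a::fin_dim_inner"
  assumes "\<rho> > 0"
  obtains \<beta> :: "'a \<Rightarrow> real" where "smooth_on UNIV \<beta>"
    and "\<And>y. y \<in> ball c \<rho> \<Longrightarrow> \<beta> y = 1" and "\<And>y. y \<notin> ball c (2 * \<rho>) \<Longrightarrow> \<beta> y = 0"
proof -
  \<comment> \<open>A smooth step, 0 for \<open>t \<le> 0\<close> and 1 for
    \<open>t \<ge> 1\<close>; the denominator has no zero because \<open>t\<close> and
    \<open>1 - t\<close> are never both nonpositive.\<close>
  define s where "s t = flat_exp 0 t * inverse (flat_exp 0 t + flat_exp 0 (1 - t))" for t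
  have pos: "flat_exp 0 t + flat_exp 0 (1 - t) \<noteq> 0" for t
    by (cases "t > 0") (auto simp: flat_exp_def add_pos_pos[THEN less_imp_neq, symmetric])
  have "smooth_on UNIV (\<lambda>t. flat_exp 0 (1 - t))"
    by (rule smooth_on_compose[OF open_UNIV subset_UNIV smooth_on_diff[OF open_UNIV smooth_on_const
            smooth_on_ident] smooth_on_flat_exp])
  then have "smooth_on UNIV (\<lambda>t. inverse (flat_exp 0 t + flat_exp 0 (1 - t)))"
    by (intro smooth_on_compose[OF open_UNIV _ _ smooth_on_real_inverse] smooth_on_add open_UNIV
        smooth_on_flat_exp) (use pos in auto)
  then have s: "smooth_on UNIV s"
    unfolding s_def by (intro smooth_on_mult open_UNIV smooth_on_flat_exp)
  have s0: "s t = 0" if "t \<le> 0" for t using that by (simp add: s_def flat_exp_def)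
  have s1: "s t = 1" if "t \<ge> 1" for t using that by (simp add: s_def flat_exp_def)
  \<comment> \<open>The squared distance keeps \<open>q\<close> smooth at \<open>c\<close>. Its
    value is at least 1 up to distance \<open>\<rho>\<close> and nonpositive once the squared
    distance reaches \<open>2 * \<rho>\<^sup>2\<close>, hence outside the ball of radius
    \<open>2 * \<rho>\<close>.\<close>
  define q where "q y = 2 - ((y - c) \<bullet> (y - c)) * (1 / \<rho>\<^sup>2)" for y
  have "smooth_on UNIV (\<lambda>y::'a. y - c)"
    by (rule smooth_on_diff[OF open_UNIV smooth_on_ident smooth_on_const])
  then have "smooth_on UNIV (\<lambda>y::'a. (y - c) \<bullet> (y - c))"
    using smooth_on_bilinear[OF open_UNIV bounded_bilinear_inner] by blast
  then have "smooth_on UNIV q"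
    unfolding q_def
    by (rule smooth_on_diff[OF open_UNIV smooth_on_const smooth_on_mult[OF open_UNIV _ smooth_on_const]])
  with s have "smooth_on UNIV (\<lambda>y. s (q y))"
    by (rule smooth_on_compose[OF open_UNIV subset_UNIV, rotated])
  moreover have "s (q y) = 1" if "y \<in> ball c \<rho>" for y
  proof (rule s1)
    have "norm (y - c) ^ 2 \<le> \<rho> ^ 2"
      using that assms by (intro power_mono) (auto simp: dist_norm norm_minus_commute)
    then show "1 \<le> q y"
      using assms by (simp add: q_def power2_norm_eq_inner field_simps)
  qed
  moreover have "s (q y) = 0" if "y \<notin> ball c (2 * \<rho>)" for y
  proof (rule s0)
    have "(2 * \<rho>) ^ 2 \<le> norm (y - c) ^ 2"
      using that assms by (intro power_mono) (auto simp: dist_norm norm_minus_commute)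
    then have "4 * \<rho>\<^sup>2 \<le> (y - c) \<bullet> (y - c)"
      by (simp add: power2_norm_eq_inner power_mult_distrib)
    moreover have "\<rho>\<^sup>2 > 0" using assms by simp
    ultimately have "2 * \<rho>\<^sup>2 \<le> (y - c) \<bullet> (y - c)" by linarith
    with \<open>\<rho>\<^sup>2 > 0\<close> show "q y \<le> 0"
      by (simp add: q_def field_simps)
  qed
  ultimately show thesis using that by blast
qed

section \<open>Smooth functions on manifolds\<close>

lemma
  assumes "smooth_atlas A" "(U, \<phi>) \<in> A"
  shows chart_open: "open U"
    and chart_image_open_range: "open (\<phi> ` U)"
    and chart_inj: "inj_on \<phi> U"
    and chart_continuous: "continuous_on U \<phi>"
    and chart_inv_continuous: "continuous_on (\<phi> ` U) (the_inv_into U \<phi>)"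
proof -
  have *: "open U \<and> open (\<phi> ` U) \<and> (\<exists>\<psi>. homeomorphism U (\<phi> ` U) \<phi> \<psi>)"
    using assms unfolding smooth_atlas_def by blast
  then obtain \<psi> where \<psi>: "homeomorphism U (\<phi> ` U) \<phi> \<psi>" by blast
  show "open U" "open (\<phi> ` U)" using * by auto
  show "continuous_on U \<phi>" using \<psi> by (simp add: homeomorphism_def)
  show inj: "inj_on \<phi> U" using \<psi> by (metis homeomorphism_def inj_on_inverseI)
  have "continuous_on (\<phi> ` U) \<psi>" using \<psi> by (simp add: homeomorphism_def)
  then show "continuous_on (\<phi> ` U) (the_inv_into U \<phi>)"
    using \<psi> inj by (subst continuous_on_cong[OF refl, of _ _ \<psi>])
      (auto simp: homeomorphism_def the_inv_into_f_f)
qed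

lemma chart_inv_chart [simp]:
  "smooth_atlas A \<Longrightarrow> (U, \<phi>) \<in> A \<Longrightarrow> p \<in> U \<Longrightarrow> the_inv_into U \<phi> (\<phi> p) = p"
  by (simp add: chart_inj the_inv_into_f_f)

lemma chart_image_open:
  assumes "smooth_atlas A" "(U, \<phi>) \<in> A" "open W"
  shows "open (\<phi> ` (U \<inter> W))"
proof -
  have "\<phi> ` (U \<inter> W) = \<phi> ` U \<inter> the_inv_into U \<phi> -` W"
    using assms by auto
  then show ?thesis
    using continuous_open_preimage[OF chart_inv_continuous chart_image_open_range] assms by metis
qed

lemma chart_vimage_open:
  assumes "smooth_atlas A" "(U, \<phi>) \<in> A" "open S"
  shows "open (U \<inter> \<phi> -` S)"
  using continuous_open_preimage[OF chart_continuous chart_open] assms by blast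

lemma chart_at:
  assumes "smooth_atlas A"
  obtains U \<phi> where "(U, \<phi>) \<in> A" "p \<in> U"
proof -
  have "p \<in> (\<Union>(U, \<phi>)\<in>A. U)" using assms by (simp add: smooth_atlas_def)
  then show thesis using that by auto
qed

lemma chart_transition_smooth:
  "smooth_atlas A \<Longrightarrow> (U, \<phi>) \<in> A \<Longrightarrow> (V, \<psi>) \<in> A \<Longrightarrow>
   smooth_on (\<phi> ` (U \<inter> V)) (\<psi> \<circ> the_inv_into U \<phi>)"
  unfolding smooth_atlas_def by fast

lemma smooth_functions_chart:
  "f \<in> smooth_functions A \<Longrightarrow> (U, \<phi>) \<in> A \<Longrightarrow> smooth_on (\<phi> ` U) (f \<circ> the_inv_into U \<phi>)"
  unfolding smooth_functions_def by blast

lemma smooth_functionsI: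
  assumes A: "smooth_atlas A"
    and loc: "\<And>U \<phi> p. (U, \<phi>) \<in> A \<Longrightarrow> p \<in> U \<Longrightarrow> \<exists>W. open W \<and> p \<in> W \<and> smooth_on (\<phi> ` (U \<inter> W)) (f \<circ> the_inv_into U \<phi>)"
  shows "f \<in> smooth_functions A"
  unfolding smooth_functions_def
proof safe
  fix U \<phi> assume c: "(U, \<phi>) \<in> A"
  show "smooth_on (\<phi> ` U) (f \<circ> the_inv_into U \<phi>)"
  proof (rule smooth_on_local)
    fix x assume "x \<in> \<phi> ` U"
    then obtain p where p: "p \<in> U" "x = \<phi> p" by blast
    obtain W where W: "open W" "p \<in> W" "smooth_on (\<phi> ` (U \<inter> W)) (f \<circ> the_inv_into U \<phi>)"
      using loc[OF c p(1)] by blast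
    show "\<exists>T. open T \<and> x \<in> T \<and> smooth_on T (f \<circ> the_inv_into U \<phi>)"
      by (rule exI[of _ "\<phi> ` (U \<inter> W)"]) (use W p chart_image_open[OF A c W(1)] in auto)
  qed
qed

text \<open>Here one chart around each point suffices, by smoothness of the transition maps.\<close>

lemma smooth_functionsI_chart:
  fixes A :: "('m::topological_space, 'e::fin_dim_inner) atlas"
  assumes A: "smooth_atlas A"
    and loc: "\<And>p. \<exists>V \<psi> W. (V, \<psi>) \<in> A \<and> open W \<and> p \<in> V \<inter> W \<and>
      smooth_on (\<psi> ` (V \<inter> W)) (f \<circ> the_inv_into V \<psi>)"
  shows "f \<in> smooth_functions A"
proof (rule smooth_functionsI[OF A])
  fix U \<phi> p assume c: "(U, \<phi>) \<in> A" and p: "p \<in> U"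
  obtain V \<psi> W where V: "(V, \<psi>) \<in> A" "open W" "p \<in> V \<inter> W"
      "smooth_on (\<psi> ` (V \<inter> W)) (f \<circ> the_inv_into V \<psi>)"
    using loc[of p] by blast
  have op: "open (V \<inter> W)" using V chart_open[OF A V(1)] by auto
  have "smooth_on (\<phi> ` (U \<inter> (V \<inter> W))) (\<lambda>x. (f \<circ> the_inv_into V \<psi>) ((\<psi> \<circ> the_inv_into U \<phi>) x))"
  proof (rule smooth_on_compose[OF chart_image_open[OF A c op], where T = "\<psi> ` (V \<inter> W)"
        and f = "\<psi> \<circ> the_inv_into U \<phi>" and g = "f \<circ> the_inv_into V \<psi>"])
    show "(\<psi> \<circ> the_inv_into U \<phi>) ` \<phi> ` (U \<inter> (V \<inter> W)) \<subseteq> \<psi> ` (V \<inter> W)"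
      using A c by auto
    show "smooth_on (\<phi> ` (U \<inter> (V \<inter> W))) (\<psi> \<circ> the_inv_into U \<phi>)"
      by (rule smooth_on_subset[OF chart_transition_smooth[OF A c V(1)]]) auto
  qed (rule V)
  then have "smooth_on (\<phi> ` (U \<inter> (V \<inter> W))) (f \<circ> the_inv_into U \<phi>)"
    by (rule smooth_on_cong[OF chart_image_open[OF A c op], rotated]) (use A c V(1) in auto)
  then show "\<exists>W. open W \<and> p \<in> W \<and> smooth_on (\<phi> ` (U \<inter> W)) (f \<circ> the_inv_into U \<phi>)"
    using op V(3) by blast
qed

lemma smooth_functions_const: "(\<lambda>p. c) \<in> smooth_functions A"
  by (auto simp: smooth_functions_def comp_def smooth_on_const)

lemma smooth_functions_add:
  "smooth_atlas A \<Longrightarrow> f \<in> smooth_functions A \<Longrightarrow> g \<in> smooth_functions A \<Longrightarrow>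
   (\<lambda>p. f p + g p) \<in> smooth_functions A"
  using smooth_on_add[OF chart_image_open_range] unfolding smooth_functions_def comp_def by fast

lemma smooth_functions_mult:
  "smooth_atlas A \<Longrightarrow> f \<in> smooth_functions A \<Longrightarrow> g \<in> smooth_functions A \<Longrightarrow>
   (\<lambda>p. f p * g p) \<in> smooth_functions A"
  using smooth_on_mult[OF chart_image_open_range] unfolding smooth_functions_def comp_def by fast

lemma smooth_functions_sum:
  assumes "smooth_atlas A" "\<And>i. i \<in> I \<Longrightarrow> f i \<in> smooth_functions A"
  shows "(\<lambda>p. \<Sum>i\<in>I. f i p) \<in> smooth_functions A"
  using assms(2) by (induction I rule: infinite_finite_induct)
    (auto intro: smooth_functions_const smooth_functions_add[OF assms(1)])

lemma smooth_functions_compose: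
  fixes A :: "('m::topological_space, 'd::fin_dim_inner) atlas"
    and B :: "('n::topological_space, 'e::fin_dim_inner) atlas"
  assumes A: "smooth_atlas A" and B: "smooth_atlas B" and F: "smooth_map A B F"
    and f: "f \<in> smooth_functions B"
  shows "(\<lambda>p. f (F p)) \<in> smooth_functions A"
proof (rule smooth_functionsI[OF A])
  fix U \<phi> p assume c: "(U, \<phi>) \<in> A" and p: "p \<in> U"
  obtain V \<psi> where V: "(V, \<psi>) \<in> B" "F p \<in> V" by (rule chart_at[OF B])
  have "continuous_on UNIV F" using F by (simp add: smooth_map_def)
  then have op: "open (F -` V)" using chart_open[OF B V(1)] by (simp add: open_vimage)
  note op' = chart_image_open[OF A c op]
  have "smooth_on (\<phi> ` (U \<inter> F -` V)) (\<psi> \<circ> F \<circ> the_inv_into U \<phi>)"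
    using F c V(1) unfolding smooth_map_def by fast
  then have "smooth_on (\<phi> ` (U \<inter> F -` V))
      (\<lambda>x. (f \<circ> the_inv_into V \<psi>) ((\<psi> \<circ> F \<circ> the_inv_into U \<phi>) x))"
    by (rule smooth_on_compose[OF op' _ _ smooth_functions_chart[OF f V(1)], rotated]) (use A c in auto)
  then have "smooth_on (\<phi> ` (U \<inter> F -` V)) ((\<lambda>p. f (F p)) \<circ> the_inv_into U \<phi>)"
    by (rule smooth_on_cong[OF op', rotated]) (use A B c V(1) in auto)
  then show "\<exists>W. open W \<and> p \<in> W \<and> smooth_on (\<phi> ` (U \<inter> W)) ((\<lambda>p. f (F p)) \<circ> the_inv_into U \<phi>)"
    using op V(2) by (intro exI[of _ "F -` V"]) auto
qed

section \<open>Smooth maps and product manifolds\<close>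

lemma smooth_map_const: "smooth_map A B (\<lambda>p. c)"
  by (auto simp: smooth_map_def comp_def smooth_on_const)

lemma smooth_map_ident: "smooth_atlas A \<Longrightarrow> smooth_map A A (\<lambda>p. p)"
  using chart_transition_smooth unfolding smooth_map_def by (fastforce simp: comp_def)

lemma smooth_map_Pair:
  fixes A :: "('m::topological_space, 'd::fin_dim_inner) atlas"
  assumes A: "smooth_atlas A" and B: "smooth_atlas B" and C: "smooth_atlas C"
    and F: "smooth_map A B F" and G: "smooth_map A C G"
  shows "smooth_map A (prod_atlas B C) (\<lambda>p. (F p, G p))"
proof -
  have cont: "continuous_on UNIV F" "continuous_on UNIV G"
    using F G by (auto simp: smooth_map_def)
  have "smooth_on (\<phi> ` (U \<inter> (\<lambda>p. (F p, G p)) -` (V \<times> W)))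
      (map_prod \<psi> \<kappa> \<circ> (\<lambda>p. (F p, G p)) \<circ> the_inv_into U \<phi>)"
    if c: "(U, \<phi>) \<in> A" "(V, \<psi>) \<in> B" "(W, \<kappa>) \<in> C" for U \<phi> V \<psi> W \<kappa>
  proof -
    have "open (F -` V)" "open (G -` W)"
      using cont chart_open[OF B c(2)] chart_open[OF C c(3)] by (simp_all add: open_vimage)
    then have op: "open (\<phi> ` (U \<inter> (F -` V \<inter> G -` W)))"
      by (intro chart_image_open[OF A c(1)] open_Int)
    have "smooth_on (\<phi> ` (U \<inter> F -` V)) (\<psi> \<circ> F \<circ> the_inv_into U \<phi>)"
      "smooth_on (\<phi> ` (U \<inter> G -` W)) (\<kappa> \<circ> G \<circ> the_inv_into U \<phi>)"
      using F G c unfolding smooth_map_def by fast+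
    then have "smooth_on (\<phi> ` (U \<inter> (F -` V \<inter> G -` W))) (\<psi> \<circ> F \<circ> the_inv_into U \<phi>)"
      "smooth_on (\<phi> ` (U \<inter> (F -` V \<inter> G -` W))) (\<kappa> \<circ> G \<circ> the_inv_into U \<phi>)"
      by (auto elim!: smooth_on_subset)
    from smooth_on_Pair[OF op this]
    show ?thesis by (simp add: comp_def vimage_def Int_def conj_ac)
  qed
  then show ?thesis
    using cont unfolding smooth_map_def prod_atlas_def by (auto intro!: continuous_on_Pair)
qed

lemma the_inv_into_map_prod:
  assumes "inj_on \<phi> U" "inj_on \<psi> V" "x \<in> \<phi> ` U" "y \<in> \<psi> ` V"
  shows "the_inv_into (U \<times> V) (map_prod \<phi> \<psi>) (x, y) = (the_inv_into U \<phi> x, the_inv_into V \<psi> y)"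
  using assms by (intro the_inv_into_f_eq map_prod_inj_on) (auto simp: the_inv_into_f_f)

lemma smooth_atlas_prod:
  fixes A :: "('m::topological_space, 'd::fin_dim_inner) atlas"
    and B :: "('n::topological_space, 'e::fin_dim_inner) atlas"
  assumes A: "smooth_atlas A" and B: "smooth_atlas B"
  shows "smooth_atlas (prod_atlas A B)"
  unfolding smooth_atlas_def
proof (intro conjI ballI)
  show "(\<Union>(U, \<phi>)\<in>prod_atlas A B. U) = UNIV"
  proof (intro equalityI subsetI)
    fix p :: "'m \<times> 'n"
    obtain U \<phi> where U: "(U, \<phi>) \<in> A" "fst p \<in> U" by (rule chart_at[OF A])
    obtain V \<psi> where V: "(V, \<psi>) \<in> B" "snd p \<in> V" by (rule chart_at[OF B])
    have "(U \<times> V, map_prod \<phi> \<psi>) \<in> prod_atlas A B" "p \<in> U \<times> V"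
      using U V by (auto simp: prod_atlas_def mem_Times_iff)
    then show "p \<in> (\<Union>(U, \<phi>)\<in>prod_atlas A B. U)" by blast
  qed simp
next
  fix c assume "c \<in> prod_atlas A B"
  then obtain U \<phi> V \<psi> where c: "c = (U \<times> V, map_prod \<phi> \<psi>)" and U: "(U, \<phi>) \<in> A" and V: "(V, \<psi>) \<in> B"
    unfolding prod_atlas_def by blast
  note iU = chart_inj[OF A U] and iV = chart_inj[OF B V]
  have im: "map_prod \<phi> \<psi> ` (U \<times> V) = \<phi> ` U \<times> \<psi> ` V" by (rule map_prod_image)
  have hom: "homeomorphism (U \<times> V) (map_prod \<phi> \<psi> ` (U \<times> V)) (map_prod \<phi> \<psi>)
      (\<lambda>x. (the_inv_into U \<phi> (fst x), the_inv_into V \<psi> (snd x)))"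
    unfolding homeomorphism_def im
  proof (intro conjI)
    show "continuous_on (U \<times> V) (map_prod \<phi> \<psi>)"
      unfolding map_prod_def case_prod_unfold
      by (intro continuous_on_Pair continuous_on_compose2[OF chart_continuous[OF A U]]
          continuous_on_compose2[OF chart_continuous[OF B V]] continuous_intros) auto
    show "continuous_on (\<phi> ` U \<times> \<psi> ` V) (\<lambda>x. (the_inv_into U \<phi> (fst x), the_inv_into V \<psi> (snd x)))"
      by (intro continuous_on_Pair continuous_on_compose2[OF chart_inv_continuous[OF A U]]
          continuous_on_compose2[OF chart_inv_continuous[OF B V]] continuous_intros) auto
  qed (use iU iV in \<open>force simp: the_inv_into_f_f image_iff\<close>)+
  show "case c of (U, \<phi>) \<Rightarrow> open U \<and> open (\<phi> ` U) \<and> (\<exists>\<psi>. homeomorphism U (\<phi> ` U) \<phi> \<psi>)"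
    unfolding c prod.case
    using hom im chart_open[OF A U] chart_open[OF B V] chart_image_open_range[OF A U]
      chart_image_open_range[OF B V] by (auto simp: open_Times)
  show "case c of (U, \<phi>) \<Rightarrow> \<forall>(V, \<psi>)\<in>prod_atlas A B. smooth_on (\<phi> ` (U \<inter> V)) (\<psi> \<circ> the_inv_into U \<phi>)"
    unfolding c prod.case
  proof
    fix c' assume "c' \<in> prod_atlas A B"
    then obtain U' \<phi>' V' \<psi>' where c': "c' = (U' \<times> V', map_prod \<phi>' \<psi>')"
      and U': "(U', \<phi>') \<in> A" and V': "(V', \<psi>') \<in> B"
      unfolding prod_atlas_def by blast
    have im': "map_prod \<phi> \<psi> ` (U \<times> V \<inter> U' \<times> V') = \<phi> ` (U \<inter> U') \<times> \<psi> ` (V \<inter> V')"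
      by (simp only: Times_Int_Times map_prod_image)
    have op: "open (\<phi> ` (U \<inter> U') \<times> \<psi> ` (V \<inter> V'))"
      by (intro open_Times chart_image_open[OF A U] chart_image_open[OF B V] chart_open[OF A U'] chart_open[OF B V'])
    have "smooth_on (\<phi> ` (U \<inter> U') \<times> \<psi> ` (V \<inter> V')) (\<lambda>x. (\<phi>' \<circ> the_inv_into U \<phi>) (fst x))"
      by (rule smooth_on_compose[OF op _ _ chart_transition_smooth[OF A U U']])
        (auto intro!: smooth_on_bounded_linear[OF op bounded_linear_fst smooth_on_ident])
    moreover have "smooth_on (\<phi> ` (U \<inter> U') \<times> \<psi> ` (V \<inter> V')) (\<lambda>x. (\<psi>' \<circ> the_inv_into V \<psi>) (snd x))"
      by (rule smooth_on_compose[OF op _ _ chart_transition_smooth[OF B V V']])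
        (auto intro!: smooth_on_bounded_linear[OF op bounded_linear_snd smooth_on_ident])
    ultimately have "smooth_on (\<phi> ` (U \<inter> U') \<times> \<psi> ` (V \<inter> V'))
       (\<lambda>x. ((\<phi>' \<circ> the_inv_into U \<phi>) (fst x), (\<psi>' \<circ> the_inv_into V \<psi>) (snd x)))"
      by (rule smooth_on_Pair[OF op])
    then have "smooth_on (\<phi> ` (U \<inter> U') \<times> \<psi> ` (V \<inter> V'))
        (map_prod \<phi>' \<psi>' \<circ> the_inv_into (U \<times> V) (map_prod \<phi> \<psi>))"
      by (rule smooth_on_cong[OF op, rotated]) (use iU iV in \<open>auto simp: the_inv_into_map_prod\<close>)
    then show "case c' of (W, \<theta>) \<Rightarrow>
        smooth_on (map_prod \<phi> \<psi> ` (U \<times> V \<inter> W)) (\<theta> \<circ> the_inv_into (U \<times> V) (map_prod \<phi> \<psi>))"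
      unfolding c' prod.case im' .
  qed
qed

section \<open>Cutting off functions given in a chart\<close>

lemma compact_cball_fin_dim: "compact (cball (c :: 'a::fin_dim_inner) e)"
proof -
  \<comment> \<open>Minkowski sums of finitely many compact segments are compact. By Cauchy-Schwarz
    the ball lies in such a sum over the orthonormal basis, as a closed subset.\<close>
  have "\<exists>K. compact K \<and> (\<forall>t. (\<forall>b\<in>B. t b \<in> {-R..R}) \<longrightarrow> (\<Sum>b\<in>B. t b *\<^sub>R b) \<in> K)"
    if "finite B" for B :: "'a set" and R :: real
    using that
  proof (induction B rule: finite_induct)
    case empty
    then show ?case by (intro exI[of _ "{0}"]) auto
  next
    case (insert b B)
    then obtain K where K: "compact K" "\<forall>t. (\<forall>b\<in>B. t b \<in> {-R..R}) \<longrightarrow> (\<Sum>b\<in>B. t b *\<^sub>R b) \<in> K"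
      by blast
    let ?L = "(\<lambda>s. s *\<^sub>R b) ` {-R..R}"
    have "compact ?L" by (intro compact_continuous_image continuous_intros compact_Icc)
    then have "compact {x + y | x y. x \<in> ?L \<and> y \<in> K}" using K(1) by (rule compact_sums)
    then show ?case
    proof (intro exI[of _ "{x + y | x y. x \<in> ?L \<and> y \<in> K}"] conjI allI impI)
      fix t assume t: "\<forall>c\<in>insert b B. t c \<in> {-R..R}"
      have "(\<Sum>c\<in>insert b B. t c *\<^sub>R c) = t b *\<^sub>R b + (\<Sum>c\<in>B. t c *\<^sub>R c)"
        using insert(1,2) by simp
      moreover have "t b *\<^sub>R b \<in> ?L" "(\<Sum>c\<in>B. t c *\<^sub>R c) \<in> K" using t K(2) by auto
      ultimately show "(\<Sum>c\<in>insert b B. t c *\<^sub>R c) \<in> {x + y | x y. x \<in> ?L \<and> y \<in> K}" by blast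
    qed
  qed
  from this[OF finite_orth_basis, of "norm c + e"] obtain K :: "'a set"
    where K: "compact K" "\<And>t. \<forall>b\<in>orth_basis. t b \<in> {-(norm c + e)..norm c + e} \<Longrightarrow>
      (\<Sum>b\<in>orth_basis. t b *\<^sub>R b) \<in> K"
    by blast
  have "cball c e \<subseteq> K"
  proof
    fix x assume "x \<in> cball c e"
    then have "norm (x - c) \<le> e" by (simp add: dist_norm norm_minus_commute)
    then have x: "norm x \<le> norm c + e" by (meson norm_triangle_sub add_left_mono order_trans)
    have "x \<bullet> b \<in> {-(norm c + e)..norm c + e}" if "b \<in> orth_basis" for b
    proof -
      have "\<bar>x \<bullet> b\<bar> \<le> norm c + e"
        using Cauchy_Schwarz_ineq2[of x b] norm_orth_basis[OF that] x by simp
      then show ?thesis unfolding atLeastAtMost_iff by linarith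
    qed
    then have "\<forall>b\<in>orth_basis. x \<bullet> b \<in> {-(norm c + e)..norm c + e}" by blast
    from K(2)[OF this] show "x \<in> K" by (simp add: orth_basis_expand)
  qed
  then show ?thesis
    using K(1) compact_Int_closed[of K "cball c e"] by (simp add: inf.absorb2)
qed

definition chart_extension :: "'m set \<Rightarrow> ('m \<Rightarrow> 'e) \<Rightarrow> 'e set \<Rightarrow> ('e \<Rightarrow> real) \<Rightarrow> 'm \<Rightarrow> real" where
  "chart_extension U \<phi> S h p = (if p \<in> U \<and> \<phi> p \<in> S then h (\<phi> p) else 0)"

text \<open>In a Hausdorff space the preimage of the compact set \<open>K\<close> is closed. Its
  complement, where the extension is 0, and the part of the chart over \<open>S\<close> are two open
  sets covering the manifold, and smoothness is clear on each.\<close>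

lemma smooth_functions_chart_extension:
  fixes A :: "('m::t2_space, 'e::fin_dim_inner) atlas"
  assumes A: "smooth_atlas A" and U: "(U, \<phi>) \<in> A"
    and S: "open S" "S \<subseteq> \<phi> ` U" and h: "smooth_on S h"
    and K: "compact K" "K \<subseteq> S" "\<And>y. y \<in> S - K \<Longrightarrow> h y = 0"
  shows "chart_extension U \<phi> S h \<in> smooth_functions A"
proof (rule smooth_functionsI_chart[OF A])
  fix p
  show "\<exists>V \<psi> W. (V, \<psi>) \<in> A \<and> open W \<and> p \<in> V \<inter> W \<and>
      smooth_on (\<psi> ` (V \<inter> W)) (chart_extension U \<phi> S h \<circ> the_inv_into V \<psi>)"
  proof (cases "p \<in> U \<and> \<phi> p \<in> S")
    case True
    let ?W = "U \<inter> \<phi> -` S"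
    have op: "open ?W" by (rule chart_vimage_open[OF A U S(1)])
    have "smooth_on (\<phi> ` (U \<inter> ?W)) h" by (rule smooth_on_subset[OF h]) auto
    then have "smooth_on (\<phi> ` (U \<inter> ?W)) (chart_extension U \<phi> S h \<circ> the_inv_into U \<phi>)"
      by (rule smooth_on_cong[OF chart_image_open[OF A U op], rotated])
        (use A U in \<open>auto simp: chart_extension_def\<close>)
    with U op True show ?thesis by blast
  next
    case False
    let ?K = "the_inv_into U \<phi> ` K"
    have "compact ?K"
      using chart_inv_continuous[OF A U] K(1,2) S(2)
      by (intro compact_continuous_image) (auto intro: continuous_on_subset)
    then have op: "open (- ?K)" using compact_imp_closed by blast
    have "p \<notin> ?K"
    proof
      assume "p \<in> ?K"
      then obtain x where x: "x \<in> K" "p = the_inv_into U \<phi> x" by blast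
      then obtain q where "q \<in> U" "x = \<phi> q" using K(2) S(2) by blast
      with False x K(2) A U show False by auto
    qed
    obtain V \<psi> where V: "(V, \<psi>) \<in> A" "p \<in> V" by (rule chart_at[OF A])
    have "chart_extension U \<phi> S h q = 0" if "q \<notin> ?K" for q
    proof (cases "q \<in> U \<and> \<phi> q \<in> S")
      case True
      then have "\<phi> q \<notin> K" using that A U by (metis chart_inv_chart image_eqI)
      then show ?thesis using True K(3) by (auto simp: chart_extension_def)
    qed (auto simp: chart_extension_def)
    then have "smooth_on (\<psi> ` (V \<inter> - ?K)) (chart_extension U \<phi> S h \<circ> the_inv_into V \<psi>)"
      by (intro smooth_on_cong[OF chart_image_open[OF A V(1) op] _ smooth_on_const[of _ 0]]) (use A V(1) in auto)
    with V op \<open>p \<notin> ?K\<close> show ?thesis by (intro exI[of _ V] exI[of _ \<psi>] exI[of _ "- ?K"]) simp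
  qed
qed

text \<open>The function \<open>\<beta>\<close> is 1 up to radius \<open>e/4\<close> and 0 from
  radius \<open>e/2\<close> on, so its product with a smooth \<open>h\<close> vanishes off a compact
  part of the ball. In this way a local function becomes an admissible argument of vector fields
  without changing near \<open>c\<close>.\<close>

lemma chart_bump:
  fixes A :: "('m::t2_space, 'e::fin_dim_inner) atlas"
  assumes A: "smooth_atlas A" and U: "(U, \<phi>) \<in> A" and S: "open S" "S \<subseteq> \<phi> ` U" and c: "c \<in> S"
  obtains e d and \<beta> :: "'e \<Rightarrow> real" where "e > 0" "d > 0" "ball c e \<subseteq> S" "ball c d \<subseteq> ball c e"
    and "\<And>y. y \<in> ball c d \<Longrightarrow> \<beta> y = 1"
    and "\<And>h. smooth_on (ball c e) h \<Longrightarrow>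
      chart_extension U \<phi> (ball c e) (\<lambda>y. \<beta> y * h y) \<in> smooth_functions A"
proof -
  obtain e where e: "e > 0" "ball c e \<subseteq> S" using S(1) c by (meson openE)
  have "e/4 > 0" using e(1) by simp
  then obtain \<beta> :: "'e \<Rightarrow> real" where \<beta>: "smooth_on UNIV \<beta>" "\<And>y. y \<in> ball c (e/4) \<Longrightarrow> \<beta> y = 1"
      "\<And>y. y \<notin> ball c (2 * (e/4)) \<Longrightarrow> \<beta> y = 0"
    by (rule smooth_bump[where c = c]) blast
  show thesis
  proof (rule that[of e "e/4" \<beta>])
    fix h :: "'e \<Rightarrow> real" assume h: "smooth_on (ball c e) h"
    show "chart_extension U \<phi> (ball c e) (\<lambda>y. \<beta> y * h y) \<in> smooth_functions A"
    proof (rule smooth_functions_chart_extension[OF A U open_ball])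
      show "smooth_on (ball c e) (\<lambda>y. \<beta> y * h y)"
        using \<beta>(1) h by (auto intro!: smooth_on_mult elim: smooth_on_subset)
      show "compact (cball c (2 * (e/4)))" by (rule compact_cball_fin_dim)
    qed (use e S \<beta>(3) in auto)
  qed (use e \<beta>(2) in auto)
qed

section \<open>Vector fields in charts\<close>

lemma
  assumes "X \<in> vector_fields A"
  shows vector_field_smooth: "f \<in> smooth_functions A \<Longrightarrow> X f \<in> smooth_functions A"
    and vector_field_non_smooth: "f \<notin> smooth_functions A \<Longrightarrow> X f = (\<lambda>p. 0)"
    and vector_field_add: "f \<in> smooth_functions A \<Longrightarrow> g \<in> smooth_functions A \<Longrightarrow>
      X (\<lambda>p. f p + g p) = (\<lambda>p. X f p + X g p)"
    and vector_field_cmult: "f \<in> smooth_functions A \<Longrightarrow> X (\<lambda>p. c * f p) = (\<lambda>p. c * X f p)"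
    and vector_field_mult: "f \<in> smooth_functions A \<Longrightarrow> g \<in> smooth_functions A \<Longrightarrow>
      X (\<lambda>p. f p * g p) = (\<lambda>p. X f p * g p + f p * X g p)"
  using assms unfolding vector_fields_def by blast+

lemma vector_fieldI:
  assumes "\<And>f. f \<in> smooth_functions A \<Longrightarrow> X f \<in> smooth_functions A"
    and "\<And>f. f \<notin> smooth_functions A \<Longrightarrow> X f = (\<lambda>p. 0)"
    and "\<And>f g. f \<in> smooth_functions A \<Longrightarrow> g \<in> smooth_functions A \<Longrightarrow>
      X (\<lambda>p. f p + g p) = (\<lambda>p. X f p + X g p)"
    and "\<And>c f. f \<in> smooth_functions A \<Longrightarrow> X (\<lambda>p. c * f p) = (\<lambda>p. c * X f p)"
    and "\<And>f g. f \<in> smooth_functions A \<Longrightarrow> g \<in> smooth_functions A \<Longrightarrow>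
      X (\<lambda>p. f p * g p) = (\<lambda>p. X f p * g p + f p * X g p)"
  shows "X \<in> vector_fields A"
  using assms unfolding vector_fields_def by blast

lemma vector_field_const: "X \<in> vector_fields A \<Longrightarrow> X (\<lambda>p. c) = (\<lambda>p. 0)"
proof -
  assume X: "X \<in> vector_fields A"
  have "X (\<lambda>p. 1 * 1) = (\<lambda>p. X (\<lambda>p. 1) p * 1 + 1 * X (\<lambda>p. 1) p)"
    by (rule vector_field_mult[OF X]) (rule smooth_functions_const)+
  then have "X (\<lambda>p. 1) = (\<lambda>p. 0)" by (simp add: fun_eq_iff)
  with vector_field_cmult[OF X smooth_functions_const[of 1], of c] show ?thesis by simp
qed

lemma vector_field_sum:
  assumes A: "smooth_atlas A" and X: "X \<in> vector_fields A"
    and f: "\<And>i. i \<in> I \<Longrightarrow> f i \<in> smooth_functions A"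
  shows "X (\<lambda>p. \<Sum>i\<in>I. f i p) = (\<lambda>p. \<Sum>i\<in>I. X (f i) p)"
  using f
proof (induction I rule: infinite_finite_induct)
  case (insert i I)
  then show ?case
    using vector_field_add[OF X, of "f i" "\<lambda>p. \<Sum>i\<in>I. f i p"] smooth_functions_sum[OF A, of I f]
    by simp
qed (auto simp: vector_field_const[OF X])

text \<open>The cut-off coordinate functions \<open>x b\<close> are chosen before \<open>h\<close>
  and \<open>p\<close>. The coefficients \<open>X (x b)\<close> are thus fixed smooth functions on
  the manifold, so the formula remains useful when \<open>p\<close> varies.\<close>

lemma vector_field_local:
  fixes A :: "('m::t2_space, 'e::fin_dim_inner) atlas"
  assumes A: "smooth_atlas A" and X: "X \<in> vector_fields A" and U: "(U, \<phi>) \<in> A" and p0: "p0 \<in> U"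
  obtains W x where "open W" "p0 \<in> W" "W \<subseteq> U" "\<And>b. x b \<in> smooth_functions A"
    and "\<And>h p. h \<in> smooth_functions A \<Longrightarrow> p \<in> W \<Longrightarrow>
      X h p = (\<Sum>b\<in>orth_basis. X (x b) p * frechet_derivative (h \<circ> the_inv_into U \<phi>) (at (\<phi> p)) b)"
proof -
  obtain e d \<beta> where e: "e > 0" "d > 0" "ball (\<phi> p0) e \<subseteq> \<phi> ` U" "ball (\<phi> p0) d \<subseteq> ball (\<phi> p0) e"
    and \<beta>: "\<And>y. y \<in> ball (\<phi> p0) d \<Longrightarrow> \<beta> y = 1"
    and ext: "\<And>h. smooth_on (ball (\<phi> p0) e) h \<Longrightarrow>
      chart_extension U \<phi> (ball (\<phi> p0) e) (\<lambda>y. \<beta> y * h y) \<in> smooth_functions A"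
    using chart_bump[OF A U chart_image_open_range[OF A U] subset_refl] p0 by blast
  define x where "x b = chart_extension U \<phi> (ball (\<phi> p0) e) (\<lambda>y. \<beta> y * (y \<bullet> b))" for b
  define W where "W = U \<inter> \<phi> -` ball (\<phi> p0) d"
  have x: "x b \<in> smooth_functions A" for b
    unfolding x_def
    by (rule ext, rule smooth_on_bounded_linear[OF open_ball bounded_linear_inner_left smooth_on_ident])
  have xW: "x b q = \<phi> q \<bullet> b" if "q \<in> W" for b q
    using that e(4) \<beta>[of "\<phi> q"] by (auto simp: x_def W_def chart_extension_def simp del: mem_ball)
  show thesis
  proof (rule that[of W x])
    show "open W" unfolding W_def by (rule chart_vimage_open[OF A U open_ball])
    show "p0 \<in> W" "W \<subseteq> U" using p0 e by (auto simp: W_def)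
    fix h p assume h: "h \<in> smooth_functions A" and p: "p \<in> W"
    define y0 where "y0 = \<phi> p"
    define H where "H = h \<circ> the_inv_into U \<phi>"
    have pU: "p \<in> U" and y0: "y0 \<in> ball (\<phi> p0) d" using p by (auto simp: W_def y0_def)
    have "ball (\<phi> p0) d \<subseteq> \<phi> ` U" using e by blast
    \<comment> \<open>A second cut-off around \<open>p\<close>, supported where the first one is 1,
      so that the functions \<open>x b\<close> are the true coordinates wherever the second one is
      nonzero.\<close>
    from chart_bump[OF A U open_ball this y0] obtain e' d' \<beta>'
      where e': "e' > 0" "d' > 0" "ball y0 e' \<subseteq> ball (\<phi> p0) d" "ball y0 d' \<subseteq> ball y0 e'"
      and \<beta>': "\<And>y. y \<in> ball y0 d' \<Longrightarrow> \<beta>' y = (1::real)"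
      and ext': "\<And>h. smooth_on (ball y0 e') h \<Longrightarrow>
        chart_extension U \<phi> (ball y0 e') (\<lambda>y. \<beta>' y * h y) \<in> smooth_functions A"
      by blast
    have "smooth_on (ball y0 e') H"
      unfolding H_def by (rule smooth_on_subset[OF smooth_functions_chart[OF h U]]) (use e e' in blast)
    then obtain g :: "'e \<Rightarrow> 'e \<Rightarrow> real" where g: "\<And>b. smooth_on (ball y0 e') (g b)"
        "\<And>b. g b y0 = frechet_derivative H (at y0) b"
        "\<And>y. y \<in> ball y0 e' \<Longrightarrow> H y = H y0 + (\<Sum>b\<in>orth_basis. ((y - y0) \<bullet> b) * g b y)"
      by (rule hadamard) blast
    define \<kappa> where "\<kappa> = chart_extension U \<phi> (ball y0 e') (\<lambda>y. \<beta>' y * 1)"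
    define G where "G b = chart_extension U \<phi> (ball y0 e') (\<lambda>y. \<beta>' y * g b y)" for b
    have \<kappa>: "\<kappa> \<in> smooth_functions A" unfolding \<kappa>_def by (rule ext'[OF smooth_on_const])
    have G: "G b \<in> smooth_functions A" for b unfolding G_def by (rule ext'[OF g(1)])
    have y0e': "y0 \<in> ball y0 e'" "y0 \<in> ball y0 d'" using e' by auto
    have \<kappa>p: "\<kappa> p = 1" and Gp: "G b p = g b y0" for b
      using pU y0e' \<beta>'[of y0] by (auto simp: \<kappa>_def G_def chart_extension_def y0_def)
    \<comment> \<open>Hadamard's formula multiplied by the cut-off is an identity between global
      smooth functions, to which \<open>X\<close> can be applied.\<close>
    have key: "\<kappa> q * h q = h p * \<kappa> q + (\<Sum>b\<in>orth_basis. (x b q + - (y0 \<bullet> b)) * G b q)" for q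
    proof (cases "q \<in> U \<and> \<phi> q \<in> ball y0 e'")
      case True
      then have "q \<in> W" using e'(3) by (auto simp: W_def)
      have "h q = H (\<phi> q)" "h p = H y0"
        using True pU A U by (simp_all add: H_def y0_def)
      with g(3)[of "\<phi> q"] True
      have "h q = h p + (\<Sum>b\<in>orth_basis. ((\<phi> q - y0) \<bullet> b) * g b (\<phi> q))" by simp
      then have "\<beta>' (\<phi> q) * h q = h p * \<beta>' (\<phi> q) +
          (\<Sum>b\<in>orth_basis. (\<phi> q \<bullet> b + - (y0 \<bullet> b)) * (\<beta>' (\<phi> q) * g b (\<phi> q)))"
        by (simp add: algebra_simps sum_distrib_left inner_diff_left)
      then show ?thesis
        using True xW[OF \<open>q \<in> W\<close>] by (simp add: \<kappa>_def G_def chart_extension_def del: mem_ball)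
    next
      case False
      then have "\<kappa> q = 0" "\<And>b. G b q = 0" unfolding \<kappa>_def G_def chart_extension_def by auto
      then show ?thesis by simp
    qed
    have xc: "(\<lambda>q. x b q + - (y0 \<bullet> b)) \<in> smooth_functions A" for b
      by (intro smooth_functions_add[OF A] x smooth_functions_const)
    have Xxc: "X (\<lambda>q. x b q + - (y0 \<bullet> b)) = X (x b)" for b
      using vector_field_add[OF X x smooth_functions_const] vector_field_const[OF X]
      by (simp del: add_uminus_conv_diff)
    have terms: "(\<lambda>q. (x b q + - (y0 \<bullet> b)) * G b q) \<in> smooth_functions A" for b
      by (intro smooth_functions_mult[OF A] xc G)
    \<comment> \<open>Both sides contribute the same term \<open>X \<kappa> p * h p\<close>, which
      cancels. In the sum only the derivatives of the coordinates survive, because the shifted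
      coordinates vanish at \<open>p\<close>.\<close>
    have "X (\<lambda>q. \<kappa> q * h q) p = X \<kappa> p * h p + X h p"
      using vector_field_mult[OF X \<kappa> h] \<kappa>p by simp
    moreover have "X (\<lambda>q. h p * \<kappa> q + (\<Sum>b\<in>orth_basis. (x b q + - (y0 \<bullet> b)) * G b q)) p
        = h p * X \<kappa> p + (\<Sum>b\<in>orth_basis. X (\<lambda>q. (x b q + - (y0 \<bullet> b)) * G b q) p)"
    proof -
      have "X (\<lambda>q. h p * \<kappa> q + (\<Sum>b\<in>orth_basis. (x b q + - (y0 \<bullet> b)) * G b q)) p
          = X (\<lambda>q. h p * \<kappa> q) p + X (\<lambda>q. \<Sum>b\<in>orth_basis. (x b q + - (y0 \<bullet> b)) * G b q) p"
        by (rule fun_cong[OF vector_field_add[OF X smooth_functions_mult[OF A smooth_functions_const \<kappa>]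
              smooth_functions_sum[OF A terms]]])
      then show ?thesis
        by (simp only: vector_field_cmult[OF X \<kappa>] vector_field_sum[OF A X terms])
    qed
    moreover have "X (\<lambda>q. (x b q + - (y0 \<bullet> b)) * G b q) p = X (x b) p * frechet_derivative H (at y0) b" for b
      using vector_field_mult[OF X xc G, of b b] xW[OF p, of b, folded y0_def]
      by (simp add: Xxc Gp g(2) del: add_uminus_conv_diff)
    ultimately show "X h p =
        (\<Sum>b\<in>orth_basis. X (x b) p * frechet_derivative (h \<circ> the_inv_into U \<phi>) (at (\<phi> p)) b)"
      unfolding key H_def[symmetric] y0_def[symmetric] by simp
  qed (rule x)
qed

section \<open>Partial differentiation on product manifolds\<close>

lemma smooth_functions_slice:
  fixes A :: "('m::topological_space, 'd::fin_dim_inner) atlas"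
    and B :: "('n::topological_space, 'e::fin_dim_inner) atlas"
  assumes A: "smooth_atlas A" and B: "smooth_atlas B" and F: "F \<in> smooth_functions (prod_atlas A B)"
  shows "(\<lambda>s. F (q, s)) \<in> smooth_functions B" and "(\<lambda>q. F (q, s)) \<in> smooth_functions A"
  using smooth_functions_compose[OF B smooth_atlas_prod[OF A B]
      smooth_map_Pair[OF B A B smooth_map_const smooth_map_ident[OF B]] F]
    smooth_functions_compose[OF A smooth_atlas_prod[OF A B]
      smooth_map_Pair[OF A A B smooth_map_ident[OF A] smooth_map_const] F] .

text \<open>In charts \<open>X\<close> acts on the second variable with coefficients
  \<open>X (x b)\<close> that do not involve the parameter \<open>q\<close>; the result is a sum of
  products of functions smooth in both variables. Smoothness of left translated derivatives rests on
  this.\<close>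

lemma smooth_functions_partial_vector_field:
  fixes A :: "('m::topological_space, 'd::fin_dim_inner) atlas"
    and B :: "('n::t2_space, 'e::fin_dim_inner) atlas"
  assumes A: "smooth_atlas A" and B: "smooth_atlas B" and F: "F \<in> smooth_functions (prod_atlas A B)"
    and X: "X \<in> vector_fields B"
  shows "(\<lambda>(q, p). X (\<lambda>s. F (q, s)) p) \<in> smooth_functions (prod_atlas A B)"
proof (rule smooth_functionsI[OF smooth_atlas_prod[OF A B]])
  fix c \<theta> qp assume c: "(c, \<theta>) \<in> prod_atlas A B" and qp: "qp \<in> c"
  obtain U \<phi> V \<psi> where eq: "c = U \<times> V" "\<theta> = map_prod \<phi> \<psi>" and U: "(U, \<phi>) \<in> A" and V: "(V, \<psi>) \<in> B"
    using c unfolding prod_atlas_def by blast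
  obtain q0 p0 where qp0: "qp = (q0, p0)" "q0 \<in> U" "p0 \<in> V" using qp eq by auto
  note iU = chart_inj[OF A U] and iV = chart_inj[OF B V]
  obtain W x where W: "open W" "p0 \<in> W" "W \<subseteq> V" and x: "\<And>b. x b \<in> smooth_functions B"
    and loc: "\<And>h p. h \<in> smooth_functions B \<Longrightarrow> p \<in> W \<Longrightarrow>
      X h p = (\<Sum>b\<in>orth_basis. X (x b) p * frechet_derivative (h \<circ> the_inv_into V \<psi>) (at (\<psi> p)) b)"
    by (rule vector_field_local[OF B X V qp0(3)]) blast
  define \<Phi> where "\<Phi> = F \<circ> the_inv_into c \<theta>"
  have \<Phi>: "smooth_on (\<phi> ` U \<times> \<psi> ` V) \<Phi>"
    using smooth_functions_chart[OF F c] unfolding \<Phi>_def eq map_prod_image .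
  have im: "\<theta> ` (c \<inter> UNIV \<times> W) = \<phi> ` U \<times> \<psi> ` W"
    using W(3) unfolding eq Times_Int_Times by (simp add: map_prod_image inf.absorb2)
  have opW: "open (\<psi> ` W)" using chart_image_open[OF B V W(1)] W(3) by (simp add: inf.absorb2)
  then have op: "open (\<phi> ` U \<times> \<psi> ` W)" by (intro open_Times chart_image_open_range[OF A U])
  have snd: "smooth_on (\<phi> ` U \<times> \<psi> ` W) snd"
    by (rule smooth_on_bounded_linear[OF op bounded_linear_snd smooth_on_ident])
  have "smooth_on (\<phi> ` U \<times> \<psi> ` W) (\<lambda>z. \<Sum>b\<in>orth_basis.
      (X (x b) \<circ> the_inv_into V \<psi>) (snd z) * frechet_derivative \<Phi> (at z) (0, b))"
  proof (intro smooth_on_sum[OF op] smooth_on_mult[OF op])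
    fix b
    show "smooth_on (\<phi> ` U \<times> \<psi> ` W) (\<lambda>z. (X (x b) \<circ> the_inv_into V \<psi>) (snd z))"
      by (rule smooth_on_compose[OF op _ snd smooth_functions_chart[OF vector_field_smooth[OF X x] V]])
        (use W(3) in auto)
    show "smooth_on (\<phi> ` U \<times> \<psi> ` W) (\<lambda>z. frechet_derivative \<Phi> (at z) (0, b))"
      by (rule smooth_on_subset[OF smooth_on_frechet_derivative[OF \<Phi>]]) (use W(3) in auto)
  qed
  then have "smooth_on (\<phi> ` U \<times> \<psi> ` W) ((\<lambda>(q, p). X (\<lambda>s. F (q, s)) p) \<circ> the_inv_into c \<theta>)"
  proof (rule smooth_on_cong[OF op, rotated])
    fix z assume "z \<in> \<phi> ` U \<times> \<psi> ` W"
    then obtain q p where z: "z = (\<phi> q, \<psi> p)" "q \<in> U" "p \<in> W" by auto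
    then have "p \<in> V" using W(3) by auto
    have inv: "the_inv_into c \<theta> (\<phi> q, \<psi> p') = (q, p')" if "p' \<in> V" for p'
      unfolding eq using that z(2) iU iV by (subst the_inv_into_map_prod) (auto simp: the_inv_into_f_f)
    have "(\<Phi> has_derivative frechet_derivative \<Phi> (at z)) (at z)"
      by (rule smooth_on_has_derivative[OF \<Phi>]) (use z \<open>p \<in> V\<close> in auto)
    then have "(\<Phi> has_derivative frechet_derivative \<Phi> (at z)) (at (\<phi> q, \<psi> p))" by (simp add: z)
    moreover have "((\<lambda>y. (\<phi> q, y)) has_derivative (\<lambda>v. (0, v))) (at (\<psi> p))"
      by (auto intro!: derivative_eq_intros)
    ultimately have "((\<lambda>y. \<Phi> (\<phi> q, y)) has_derivative (\<lambda>v. frechet_derivative \<Phi> (at z) (0, v))) (at (\<psi> p))"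
      using has_derivative_compose by blast
    moreover have "\<Phi> (\<phi> q, y) = ((\<lambda>s. F (q, s)) \<circ> the_inv_into V \<psi>) y" if "y \<in> \<psi> ` V" for y
      using that inv B V by (auto simp: \<Phi>_def)
    ultimately have "(((\<lambda>s. F (q, s)) \<circ> the_inv_into V \<psi>) has_derivative
        (\<lambda>v. frechet_derivative \<Phi> (at z) (0, v))) (at (\<psi> p))"
      using has_derivative_transform_within_open[OF _ chart_image_open_range[OF B V]] \<open>p \<in> V\<close> by blast
    from frechet_derivative_at[OF this]
    have "frechet_derivative ((\<lambda>s. F (q, s)) \<circ> the_inv_into V \<psi>) (at (\<psi> p)) b
        = frechet_derivative \<Phi> (at z) (0, b)" for b by metis
    then show "(\<Sum>b\<in>orth_basis. (X (x b) \<circ> the_inv_into V \<psi>) (snd z) * frechet_derivative \<Phi> (at z) (0, b))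
        = ((\<lambda>(q, p). X (\<lambda>s. F (q, s)) p) \<circ> the_inv_into c \<theta>) z"
      using loc[OF smooth_functions_slice(1)[OF A B F] z(3), of q] inv[OF \<open>p \<in> V\<close>] B V \<open>p \<in> V\<close>
      by (simp add: z)
  qed
  then show "\<exists>W. open W \<and> qp \<in> W \<and>
      smooth_on (\<theta> ` (c \<inter> W)) ((\<lambda>(q, p). X (\<lambda>s. F (q, s)) p) \<circ> the_inv_into c \<theta>)"
    using W qp0 unfolding im[symmetric] by (intro exI[of _ "UNIV \<times> W"]) (auto simp: open_Times)
qed

section \<open>Algebraic operations on vector fields\<close>

lemma vf_add_vector_field:
  assumes A: "smooth_atlas A" and X: "X \<in> vector_fields A" and Y: "Y \<in> vector_fields A"
  shows "vf_add X Y \<in> vector_fields A"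
  by (rule vector_fieldI)
    (auto simp: vf_add_def vector_field_non_smooth[OF X] vector_field_non_smooth[OF Y]
      vector_field_add[OF X] vector_field_add[OF Y] vector_field_cmult[OF X] vector_field_cmult[OF Y]
      vector_field_mult[OF X] vector_field_mult[OF Y] algebra_simps
      intro!: smooth_functions_add[OF A] vector_field_smooth[OF X] vector_field_smooth[OF Y])

lemma vf_scale_vector_field:
  assumes A: "smooth_atlas A" and X: "X \<in> vector_fields A" and h: "h \<in> smooth_functions A"
  shows "vf_scale h X \<in> vector_fields A"
  by (rule vector_fieldI)
    (auto simp: vf_scale_def vector_field_non_smooth[OF X] vector_field_add[OF X]
      vector_field_cmult[OF X] vector_field_mult[OF X] algebra_simps
      intro!: smooth_functions_mult[OF A] vector_field_smooth[OF X] h)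

lemma vf_diff_vector_field:
  assumes A: "smooth_atlas A" and X: "X \<in> vector_fields A" and Y: "Y \<in> vector_fields A"
  shows "vf_diff X Y \<in> vector_fields A"
proof -
  have "vf_diff X Y = vf_add X (vf_scale (\<lambda>p. -1) Y)"
    by (simp add: vf_diff_def vf_add_def vf_scale_def)
  then show ?thesis
    using vf_add_vector_field[OF A X vf_scale_vector_field[OF A Y smooth_functions_const]] by simp
qed

text \<open>The product rule survives because the mixed terms such as \<open>X f * Y g\<close> occur
  in both compositions and cancel.\<close>

lemma vf_bracket_vector_field:
  assumes A: "smooth_atlas A" and X: "X \<in> vector_fields A" and Y: "Y \<in> vector_fields A"
  shows "vf_bracket X Y \<in> vector_fields A"
proof (rule vector_fieldI)
  note XY = vector_field_smooth[OF X] vector_field_smooth[OF Y] smooth_functions_mult[OF A]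
  fix f g :: "'a \<Rightarrow> real" and c
  show "vf_bracket X Y f = (\<lambda>p. 0)" if "f \<notin> smooth_functions A"
    using that by (simp add: vf_bracket_def vector_field_non_smooth[OF X] vector_field_non_smooth[OF Y]
        vector_field_const[OF X] vector_field_const[OF Y])
  assume f: "f \<in> smooth_functions A"
  have "(\<lambda>p. X (Y f) p + (-1) * Y (X f) p) \<in> smooth_functions A"
    by (intro smooth_functions_add[OF A] XY smooth_functions_const f)
  then show "vf_bracket X Y f \<in> smooth_functions A" by (simp add: vf_bracket_def)
  show "vf_bracket X Y (\<lambda>p. c * f p) = (\<lambda>p. c * vf_bracket X Y f p)"
    by (simp add: vf_bracket_def vector_field_cmult[OF X] vector_field_cmult[OF Y] XY f algebra_simps)
  assume g: "g \<in> smooth_functions A"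
  show "vf_bracket X Y (\<lambda>p. f p + g p) = (\<lambda>p. vf_bracket X Y f p + vf_bracket X Y g p)"
    by (simp add: vf_bracket_def vector_field_add[OF X] vector_field_add[OF Y] XY f g algebra_simps)
  show "vf_bracket X Y (\<lambda>p. f p * g p) = (\<lambda>p. vf_bracket X Y f p * g p + f p * vf_bracket X Y g p)"
    by (simp add: vf_bracket_def vector_field_mult[OF X] vector_field_mult[OF Y]
        vector_field_add[OF X] vector_field_add[OF Y] XY f g fun_eq_iff algebra_simps)
qed

section \<open>Left invariant fields form a global frame\<close>

locale lie_group_manifold =
  fixes H :: "'h::{t2_space, second_countable_topology} monoid" (structure)
    and B :: "('h, 'e::fin_dim_inner) atlas"
  assumes lie: "lie_group H B"
begin

lemma group: "group H" and carrier [simp]: "carrier H = UNIV" and atlas: "smooth_atlas B"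
  and smooth_mult: "smooth_map (prod_atlas B B) B (\<lambda>(p, q). p \<otimes> q)"
  and smooth_inv: "smooth_map B B (\<lambda>p. inv p)"
  using lie by (simp_all add: lie_group_def)

lemma group_simps [simp]:
  "\<one> \<otimes> p = p" "p \<otimes> \<one> = p" "inv p \<otimes> p = \<one>" "p \<otimes> inv p = \<one>" "inv (inv p) = p" "inv \<one> = \<one>"
  "inv p \<otimes> (p \<otimes> q) = q" "p \<otimes> (inv p \<otimes> q) = q"
proof -
  interpret group H by (rule group)
  show "\<one> \<otimes> p = p" "p \<otimes> \<one> = p" "inv p \<otimes> p = \<one>" "p \<otimes> inv p = \<one>" "inv (inv p) = p" "inv \<one> = \<one>"
    by simp_all
  show "inv p \<otimes> (p \<otimes> q) = q" "p \<otimes> (inv p \<otimes> q) = q"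
    by (simp_all add: m_assoc[symmetric])
qed

lemma mult_assoc: "p \<otimes> q \<otimes> s = p \<otimes> (q \<otimes> s)"
  using group.is_monoid[OF group, THEN monoid.m_assoc] by simp

lemma smooth_functions_mult_map:
  "f \<in> smooth_functions B \<Longrightarrow> (\<lambda>(p, q). f (p \<otimes> q)) \<in> smooth_functions (prod_atlas B B)"
  using smooth_functions_compose[OF smooth_atlas_prod[OF atlas atlas] atlas smooth_mult, of f]
  by (simp add: case_prod_unfold)

lemma smooth_functions_translate:
  assumes "f \<in> smooth_functions B"
  shows "(\<lambda>q. f (g \<otimes> q)) \<in> smooth_functions B"
  using smooth_functions_slice(1)[OF atlas atlas smooth_functions_mult_map[OF assms], of g] by simp

lemma smooth_functions_translate_iff:
  "(\<lambda>q. f (g \<otimes> q)) \<in> smooth_functions B \<longleftrightarrow> f \<in> smooth_functions B"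
proof
  assume "(\<lambda>q. f (g \<otimes> q)) \<in> smooth_functions B"
  from smooth_functions_translate[OF this, of "inv g"] show "f \<in> smooth_functions B" by simp
qed (rule smooth_functions_translate)

lemma left_push_vector_field:
  assumes X: "X \<in> vector_fields B"
  shows "left_push H g X \<in> vector_fields B"
  by (rule vector_fieldI)
    (auto simp: left_push_def vector_field_non_smooth[OF X] vector_field_add[OF X] vector_field_cmult[OF X]
      vector_field_mult[OF X] smooth_functions_translate_iff
      intro!: smooth_functions_translate vector_field_smooth[OF X])

text \<open>A tangent vector at the unit is represented by any field \<open>X\<close> with this
  value there, so no separate notion of tangent vector is introduced.\<close>

definition left_extension :: "'h operator \<Rightarrow> 'h operator" where
  "left_extension X = (\<lambda>f q. X (\<lambda>s. f (q \<otimes> s)) \<one>)"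

lemma left_extension_left_invariant:
  assumes X: "X \<in> vector_fields B"
  shows "left_extension X \<in> left_invariant_fields H B"
  unfolding left_invariant_fields_def
proof (intro CollectI conjI allI)
  show "left_extension X \<in> vector_fields B"
  proof (rule vector_fieldI)
    fix f g :: "'h \<Rightarrow> real" and c
    show "left_extension X f = (\<lambda>p. 0)" if "f \<notin> smooth_functions B"
      using that by (simp add: left_extension_def vector_field_non_smooth[OF X] smooth_functions_translate_iff)
    assume f: "f \<in> smooth_functions B"
    \<comment> \<open>The function \<open>f (q \<otimes> s)\<close> is smooth in the pair;
      differentiate it in \<open>s\<close> along \<open>X\<close>, then restrict to the slice where
      \<open>s\<close> is the unit.\<close>
    show "left_extension X f \<in> smooth_functions B"
      using smooth_functions_slice(2)[OF atlas atlas smooth_functions_partial_vector_field[OF atlas atlas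
            smooth_functions_mult_map[OF f] X], of \<one>]
      by (simp add: left_extension_def)
    show "left_extension X (\<lambda>p. c * f p) = (\<lambda>p. c * left_extension X f p)"
      by (simp add: left_extension_def vector_field_cmult[OF X] smooth_functions_translate f)
    assume g: "g \<in> smooth_functions B"
    show "left_extension X (\<lambda>p. f p + g p) = (\<lambda>p. left_extension X f p + left_extension X g p)"
      by (simp add: left_extension_def vector_field_add[OF X] smooth_functions_translate f g)
    show "left_extension X (\<lambda>p. f p * g p) = (\<lambda>p. left_extension X f p * g p + f p * left_extension X g p)"
      by (simp add: left_extension_def vector_field_mult[OF X] smooth_functions_translate f g)
  qed
  show "left_push H g (left_extension X) = left_extension X" for g
    by (simp add: left_push_def left_extension_def mult_assoc)
qed

lemma left_invariant_apply:
  assumes "X \<in> left_invariant_fields H B"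
  shows "X f (g \<otimes> p) = X (\<lambda>q. f (g \<otimes> q)) p"
proof -
  have "left_push H g X f (g \<otimes> p) = X f (g \<otimes> p)"
    using assms by (simp add: left_invariant_fields_def)
  then show ?thesis by (simp add: left_push_def)
qed

end

locale lie_group_frame = lie_group_manifold H B
  for H :: "'h::{t2_space, second_countable_topology} monoid" (structure)
    and B :: "('h, 'e::fin_dim_inner) atlas" +
  fixes br :: "'v::fin_dim_vector \<Rightarrow> 'v \<Rightarrow> 'v" and \<psi> :: "'v \<Rightarrow> 'h operator"
  assumes lie_algebra_of: "is_lie_algebra_of br H B \<psi>"
begin

lemma frame_left_invariant: "\<psi> a \<in> left_invariant_fields H B"
  using lie_algebra_of unfolding is_lie_algebra_of_def bij_betw_def by blast

lemma frame_vector_field: "\<psi> a \<in> vector_fields B"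
  using frame_left_invariant unfolding left_invariant_fields_def by blast

lemmas frame_translate = left_invariant_apply[OF frame_left_invariant]

lemma frame_bracket: "\<psi> (br a b) = vf_bracket (\<psi> a) (\<psi> b)"
  using lie_algebra_of by (simp add: is_lie_algebra_of_def)

lemma frame_linear: "linear (\<lambda>a. \<psi> a f p)"
  using lie_algebra_of
  by (intro linearI) (simp_all add: is_lie_algebra_of_def vf_add_def vf_scale_def)

text \<open>The value of \<open>X\<close> at \<open>p\<close> is moved to the unit by the inverse
  translation and spread from there; the left invariant field so obtained lies in the image of
  \<open>\<psi>\<close> and agrees with \<open>X\<close> at \<open>p\<close>.\<close>

lemma frame_spans:
  assumes X: "X \<in> vector_fields B"
  shows "\<exists>a. \<forall>f. X f p = \<psi> a f p"
proof -
  let ?L = "left_extension (left_push H (inv p) X)"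
  have "?L \<in> left_invariant_fields H B"
    by (intro left_extension_left_invariant left_push_vector_field X)
  then obtain a where a: "\<psi> a = ?L"
    using lie_algebra_of unfolding is_lie_algebra_of_def bij_betw_def by (metis imageE)
  have "?L f p = X f p" for f
    by (simp add: left_extension_def left_push_def)
  with a show ?thesis by metis
qed

text \<open>Left translation by \<open>q \<otimes> inv p\<close> carries \<open>p\<close> to
  \<open>q\<close>, so a left invariant field is determined by its value at a single point.\<close>

lemma frame_independent:
  assumes "\<And>f. \<psi> a f p = \<psi> b f p"
  shows "a = b"
proof -
  have "\<psi> a f q = \<psi> b f q" for f q
  proof -
    have "\<psi> a f (q \<otimes> inv p \<otimes> p) = \<psi> b f (q \<otimes> inv p \<otimes> p)"
      unfolding frame_translate by (rule assms)
    then show ?thesis by (simp add: mult_assoc)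
  qed
  then have "\<psi> a = \<psi> b" by (intro ext)
  then show ?thesis
    using lie_algebra_of unfolding is_lie_algebra_of_def bij_betw_def by (metis injD)
qed

section \<open>Coefficients of vector fields in the frame\<close>

definition coef :: "'h operator \<Rightarrow> 'h \<Rightarrow> 'v" where
  "coef X p = (THE a. \<forall>f. X f p = \<psi> a f p)"

lemma coefI:
  assumes "\<And>f. X f p = \<psi> a f p"
  shows "coef X p = a"
  unfolding coef_def
proof (rule the_equality)
  show "\<forall>f. X f p = \<psi> a f p" using assms by blast
  show "b = a" if "\<forall>f. X f p = \<psi> b f p" for b
    by (rule frame_independent[of b p]) (simp add: assms[symmetric] that)
qed

lemma coef: "X \<in> vector_fields B \<Longrightarrow> X f p = \<psi> (coef X p) f p"
  using frame_spans[of X p] coefI[of X p] by metis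

lemma vector_field_eqI:
  assumes "X \<in> vector_fields B" "Y \<in> vector_fields B" "\<And>p. coef X p = coef Y p"
  shows "X = Y"
  using assms coef by (intro ext) metis

text \<open>The differentials at the unit of smooth functions form a subspace of the dual, and they
  separate points because a frame field vanishing at the unit is zero.\<close>

lemma linear_functional_frame:
  assumes "linear l"
  obtains f where "f \<in> smooth_functions B" "\<And>a. l a = \<psi> a f \<one>"
proof -
  have "l \<in> (\<lambda>f a. \<psi> a f \<one>) ` smooth_functions B"
  proof (rule separating_functionals[OF _ _ _ _ _ assms])
    note fv = frame_vector_field
    show "linear s" if "s \<in> (\<lambda>f a. \<psi> a f \<one>) ` smooth_functions B" for s
      using that frame_linear by auto
    show "(\<lambda>x. 0) \<in> (\<lambda>f a. \<psi> a f \<one>) ` smooth_functions B"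
      using vector_field_const[OF fv] by (intro image_eqI[OF _ smooth_functions_const[of 0]]) simp
    show "(\<lambda>x. s x + t x) \<in> (\<lambda>f a. \<psi> a f \<one>) ` smooth_functions B"
      if st: "s \<in> (\<lambda>f a. \<psi> a f \<one>) ` smooth_functions B" "t \<in> (\<lambda>f a. \<psi> a f \<one>) ` smooth_functions B" for s t
    proof -
      obtain f g where "f \<in> smooth_functions B" "s = (\<lambda>a. \<psi> a f \<one>)"
          "g \<in> smooth_functions B" "t = (\<lambda>a. \<psi> a g \<one>)"
        using st by blast
      then show ?thesis
        by (intro image_eqI[of _ _ "\<lambda>p. f p + g p"])
          (simp_all add: vector_field_add[OF fv] smooth_functions_add[OF atlas])
    qed
    show "(\<lambda>x. k * s x) \<in> (\<lambda>f a. \<psi> a f \<one>) ` smooth_functions B"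
      if s: "s \<in> (\<lambda>f a. \<psi> a f \<one>) ` smooth_functions B" for k s
    proof -
      obtain f where "f \<in> smooth_functions B" "s = (\<lambda>a. \<psi> a f \<one>)" using s by blast
      then show ?thesis
        by (intro image_eqI[of _ _ "\<lambda>p. k * f p"])
          (simp_all add: vector_field_cmult[OF fv] smooth_functions_mult[OF atlas smooth_functions_const])
    qed
    show "\<exists>s\<in>(\<lambda>f a. \<psi> a f \<one>) ` smooth_functions B. s a \<noteq> 0" if "a \<noteq> 0" for a
    proof (rule ccontr)
      assume neg: "\<not> ?thesis"
      \<comment> \<open>Independence of the frame refers to all functions; on the nonsmooth ones
        both fields are 0 by convention.\<close>
      have "\<psi> a f \<one> = \<psi> 0 f \<one>" for f
      proof (cases "f \<in> smooth_functions B")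
        case True
        with neg show ?thesis using linear_0[OF frame_linear] by auto
      next
        case False
        then show ?thesis using vector_field_non_smooth[OF fv] by metis
      qed
      with frame_independent that show False by blast
    qed
  qed
  then show thesis using that by (auto simp: fun_eq_iff)
qed

text \<open>Tested on functionals because the Lie algebra carries no norm in which
  \<open>smooth_on\<close> could be stated.\<close>

definition smooth_coef :: "('h \<Rightarrow> 'v) \<Rightarrow> bool" where
  "smooth_coef u \<longleftrightarrow> (\<forall>l. linear l \<longrightarrow> (\<lambda>p. l (u p)) \<in> smooth_functions B)"

text \<open>If \<open>l a = \<psi> a f \<one>\<close> then \<open>l (coef X p)\<close> is \<open>X\<close> applied at \<open>p\<close> to the left translate of \<open>f\<close>
  by the inverse of \<open>p\<close>.\<close>

lemma smooth_coef_coef: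
  assumes X: "X \<in> vector_fields B"
  shows "smooth_coef (coef X)"
  unfolding smooth_coef_def
proof (intro allI impI)
  fix l :: "'v \<Rightarrow> real" assume "linear l"
  then obtain f where f: "f \<in> smooth_functions B" "\<And>a. l a = \<psi> a f \<one>"
    by (rule linear_functional_frame) blast
  have "l (coef X p) = X (\<lambda>s. f (inv p \<otimes> s)) p" for p
    using frame_translate[of "coef X p" f "inv p" p] by (simp add: f(2) coef[OF X])
  moreover have "(\<lambda>p. X (\<lambda>s. f (inv p \<otimes> s)) p) \<in> smooth_functions B"
    using smooth_functions_compose[OF atlas smooth_atlas_prod[OF atlas atlas]
        smooth_map_Pair[OF atlas atlas atlas smooth_inv smooth_map_ident[OF atlas]]
        smooth_functions_partial_vector_field[OF atlas atlas smooth_functions_mult_map[OF f(1)] X]]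
    by simp
  ultimately show "(\<lambda>p. l (coef X p)) \<in> smooth_functions B" by simp
qed

definition field_of :: "('h \<Rightarrow> 'v) \<Rightarrow> 'h operator" where
  "field_of u = (\<lambda>f p. \<psi> (u p) f p)"

lemma coef_field_of [simp]: "coef (field_of u) p = u p"
  by (rule coefI) (simp add: field_of_def)

lemma coef_frame [simp]: "coef (\<psi> a) p = a"
  by (rule coefI) simp

lemma field_of_vector_field:
  assumes u: "smooth_coef u"
  shows "field_of u \<in> vector_fields B"
proof (rule vector_fieldI)
  note fv = frame_vector_field
  fix f g :: "'h \<Rightarrow> real" and k
  show "field_of u f = (\<lambda>p. 0)" if "f \<notin> smooth_functions B"
    using that by (simp add: field_of_def vector_field_non_smooth[OF fv])
  assume f: "f \<in> smooth_functions B"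
  obtain E :: "'v set" and c where c: "\<And>b. linear (c b)" "\<And>x. (\<Sum>b\<in>E. c b x *\<^sub>R b) = x"
    by (rule fin_dim_coordinates) blast
  \<comment> \<open>In coordinates the field is a finite combination of frame fields with smooth
    coefficients.\<close>
  have "field_of u f = (\<lambda>p. \<Sum>b\<in>E. c b (u p) * \<psi> b f p)"
  proof
    fix p
    have "\<psi> (u p) f p = \<psi> (\<Sum>b\<in>E. c b (u p) *\<^sub>R b) f p" by (simp only: c(2))
    also have "\<dots> = (\<Sum>b\<in>E. c b (u p) * \<psi> b f p)"
      by (simp add: linear_sum[OF frame_linear] linear_scale[OF frame_linear])
    finally show "field_of u f p = (\<Sum>b\<in>E. c b (u p) * \<psi> b f p)" by (simp add: field_of_def)
  qed
  moreover have "(\<lambda>p. \<Sum>b\<in>E. c b (u p) * \<psi> b f p) \<in> smooth_functions B"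
    using u c(1) unfolding smooth_coef_def
    by (intro smooth_functions_sum[OF atlas] smooth_functions_mult[OF atlas] vector_field_smooth[OF fv f]) blast
  ultimately show "field_of u f \<in> smooth_functions B" by simp
  show "field_of u (\<lambda>p. k * f p) = (\<lambda>p. k * field_of u f p)"
    by (simp add: field_of_def vector_field_cmult[OF fv] f)
  assume g: "g \<in> smooth_functions B"
  show "field_of u (\<lambda>p. f p + g p) = (\<lambda>p. field_of u f p + field_of u g p)"
    by (simp add: field_of_def vector_field_add[OF fv] f g)
  show "field_of u (\<lambda>p. f p * g p) = (\<lambda>p. field_of u f p * g p + f p * field_of u g p)"
    by (simp add: field_of_def vector_field_mult[OF fv] f g)
qed

lemma coef_add:
  "X \<in> vector_fields B \<Longrightarrow> Y \<in> vector_fields B \<Longrightarrow> coef (vf_add X Y) p = coef X p + coef Y p"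
  by (rule coefI) (simp add: vf_add_def linear_add[OF frame_linear] coef[symmetric])

lemma coef_diff:
  "X \<in> vector_fields B \<Longrightarrow> Y \<in> vector_fields B \<Longrightarrow> coef (vf_diff X Y) p = coef X p - coef Y p"
  by (rule coefI) (simp add: vf_diff_def linear_diff[OF frame_linear] coef[symmetric])

lemma coef_scale:
  "X \<in> vector_fields B \<Longrightarrow> coef (vf_scale h X) p = h p *\<^sub>R coef X p"
  by (rule coefI) (simp add: vf_scale_def linear_scale[OF frame_linear] coef[symmetric])

lemma coef_left_push:
  "X \<in> vector_fields B \<Longrightarrow> coef (left_push H g X) p = coef X (inv g \<otimes> p)"
proof (rule coefI)
  fix f assume "X \<in> vector_fields B"
  then show "left_push H g X f p = \<psi> (coef X (inv g \<otimes> p)) f p"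
    using frame_translate[of "coef X (inv g \<otimes> p)" f g "inv g \<otimes> p"] coef[of X]
    by (simp add: left_push_def)
qed

subsection \<open>Derivatives of vector-valued functions\<close>

text \<open>The componentwise derivative, pinned down by all linear functionals at once; this avoids
  both limits in the Lie algebra and the choice of a basis.\<close>

definition vder :: "'h operator \<Rightarrow> ('h \<Rightarrow> 'v) \<Rightarrow> 'h \<Rightarrow> 'v" where
  "vder X u p = (THE w. \<forall>l. linear l \<longrightarrow> l w = X (\<lambda>q. l (u q)) p)"

lemma vder_eqI:
  assumes "\<And>l :: 'v \<Rightarrow> real. linear l \<Longrightarrow> l w = X (\<lambda>q. l (u q)) p"
  shows "vder X u p = w"
  unfolding vder_def
proof (rule the_equality)
  show "\<forall>l. linear l \<longrightarrow> l w = X (\<lambda>q. l (u q)) p" using assms by blast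
  show "v = w" if "\<forall>l. linear l \<longrightarrow> l v = X (\<lambda>q. l (u q)) p" for v
    by (rule linear_functionals_separate) (simp add: assms that)
qed

lemma vder:
  assumes X: "X \<in> vector_fields B" and u: "smooth_coef u" and l: "linear l"
  shows "l (vder X u p) = X (\<lambda>q. l (u q)) p"
proof -
  obtain E :: "'v set" and c where c: "\<And>b. linear (c b)" "\<And>x. (\<Sum>b\<in>E. c b x *\<^sub>R b) = x"
    by (rule fin_dim_coordinates) blast
  have cu: "(\<lambda>q. c b (u q)) \<in> smooth_functions B" for b
    using u c(1) by (simp add: smooth_coef_def)
  define w where "w = (\<Sum>b\<in>E. X (\<lambda>q. c b (u q)) p *\<^sub>R b)"
  have w: "l w = X (\<lambda>q. l (u q)) p" if l: "linear l" for l :: "'v \<Rightarrow> real"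
  proof -
    have "l (u q) = (\<Sum>b\<in>E. l b * c b (u q))" for q
    proof -
      have "l (u q) = l (\<Sum>b\<in>E. c b (u q) *\<^sub>R b)" by (simp only: c(2))
      then show ?thesis by (simp add: linear_sum[OF l] linear_scale[OF l] mult.commute)
    qed
    then have "X (\<lambda>q. l (u q)) p = X (\<lambda>q. \<Sum>b\<in>E. l b * c b (u q)) p" by simp
    also have "\<dots> = (\<Sum>b\<in>E. X (\<lambda>q. l b * c b (u q)) p)"
      by (subst vector_field_sum[OF atlas X]) (auto intro: smooth_functions_mult[OF atlas smooth_functions_const cu])
    also have "\<dots> = (\<Sum>b\<in>E. l b * X (\<lambda>q. c b (u q)) p)"
      by (simp only: vector_field_cmult[OF X cu])
    also have "\<dots> = l w" by (simp add: w_def linear_sum[OF l] linear_scale[OF l] mult.commute)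
    finally show ?thesis by simp
  qed
  then have "vder X u p = w" by (rule vder_eqI)
  with w[OF l] show ?thesis by simp
qed

lemma smooth_coef_vder:
  "X \<in> vector_fields B \<Longrightarrow> smooth_coef u \<Longrightarrow> smooth_coef (vder X u)"
  unfolding smooth_coef_def
proof (intro allI impI)
  fix l :: "'v \<Rightarrow> real"
  assume X: "X \<in> vector_fields B" and u: "\<forall>l. linear l \<longrightarrow> (\<lambda>p. l (u p)) \<in> smooth_functions B" and l: "linear l"
  have "(\<lambda>p. l (vder X u p)) = X (\<lambda>q. l (u q))"
    using vder[OF X _ l, of u] u by (auto simp: smooth_coef_def)
  moreover have "X (\<lambda>q. l (u q)) \<in> smooth_functions B" using vector_field_smooth[OF X] u l by blast
  ultimately show "(\<lambda>p. l (vder X u p)) \<in> smooth_functions B" by simp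
qed

lemma smooth_coef_add:
  assumes "smooth_coef u" "smooth_coef v" shows "smooth_coef (\<lambda>p. u p + v p)"
  unfolding smooth_coef_def
proof (intro allI impI)
  fix l :: "'v \<Rightarrow> real" assume l: "linear l"
  have "(\<lambda>p. l (u p) + l (v p)) \<in> smooth_functions B"
    using assms l by (intro smooth_functions_add[OF atlas]) (auto simp: smooth_coef_def)
  then show "(\<lambda>p. l (u p + v p)) \<in> smooth_functions B" by (simp add: linear_add[OF l])
qed

text \<open>In coordinates a bilinear expression is a combination of products of real functions, on
  which a derivation obeys the Leibniz rule. Smoothness and the derivative formula come from the
  same expansion.\<close>

lemma smooth_coef_bilinear_vder:
  assumes m: "bilinear m" and u: "smooth_coef u" and v: "smooth_coef v"
  shows "smooth_coef (\<lambda>p. m (u p) (v p))"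
    and "X \<in> vector_fields B \<Longrightarrow> vder X (\<lambda>p. m (u p) (v p)) p = m (vder X u p) (v p) + m (u p) (vder X v p)"
proof -
  obtain E :: "'v set" and c where c: "\<And>b. linear (c b)" "\<And>x. (\<Sum>b\<in>E. c b x *\<^sub>R b) = x"
    by (rule fin_dim_coordinates) blast
  have cu: "(\<lambda>q. c b (u q)) \<in> smooth_functions B" and cv: "(\<lambda>q. c b (v q)) \<in> smooth_functions B" for b
    using u v c(1) by (simp_all add: smooth_coef_def)
  have m1: "linear (\<lambda>x. m x y)" and m2: "linear (m x)" for x y
    using m by (simp_all add: bilinear_def)
  have expand: "l (m x y) = (\<Sum>a\<in>E. \<Sum>b\<in>E. l (m a b) * (c a x * c b y))"
    if l: "linear l" for l :: "'v \<Rightarrow> real" and x y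
  proof -
    have "m x y = m (\<Sum>a\<in>E. c a x *\<^sub>R a) y" by (simp only: c(2))
    also have "\<dots> = (\<Sum>a\<in>E. c a x *\<^sub>R m a y)"
      by (simp add: linear_sum[OF m1] linear_scale[OF m1])
    finally have "l (m x y) = (\<Sum>a\<in>E. c a x * l (m a y))"
      by (simp add: linear_sum[OF l] linear_scale[OF l])
    moreover have "l (m a y) = (\<Sum>b\<in>E. c b y * l (m a b))" for a
    proof -
      have "m a y = m a (\<Sum>b\<in>E. c b y *\<^sub>R b)" by (simp only: c(2))
      also have "\<dots> = (\<Sum>b\<in>E. c b y *\<^sub>R m a b)"
        by (simp add: linear_sum[OF m2] linear_scale[OF m2])
      finally show ?thesis by (simp add: linear_sum[OF l] linear_scale[OF l])
    qed
    ultimately show ?thesis by (simp add: sum_distrib_left ac_simps)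
  qed
  have sm: "(\<lambda>q. c a (u q) * c b (v q)) \<in> smooth_functions B" for a b
    by (intro smooth_functions_mult[OF atlas] cu cv)
  have sm': "(\<lambda>q. k * (c a (u q) * c b (v q))) \<in> smooth_functions B" for a b k
    by (intro smooth_functions_mult[OF atlas smooth_functions_const sm])
  show "smooth_coef (\<lambda>p. m (u p) (v p))"
    unfolding smooth_coef_def
  proof (intro allI impI)
    fix l :: "'v \<Rightarrow> real" assume l: "linear l"
    have "(\<lambda>p. \<Sum>a\<in>E. \<Sum>b\<in>E. l (m a b) * (c a (u p) * c b (v p))) \<in> smooth_functions B"
      by (rule smooth_functions_sum[OF atlas smooth_functions_sum[OF atlas sm']])
    then show "(\<lambda>p. l (m (u p) (v p))) \<in> smooth_functions B"
      by (subst ext[OF expand[OF l]])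
  qed
  assume X: "X \<in> vector_fields B"
  have X_term: "X (\<lambda>q. k * (c a (u q) * c b (v q))) p =
      k * (X (\<lambda>q. c a (u q)) p * c b (v p) + c a (u p) * X (\<lambda>q. c b (v q)) p)" for a b k
    using fun_cong[OF vector_field_cmult[OF X sm], of k a b p] fun_cong[OF vector_field_mult[OF X cu cv], of a b p]
    by metis
  show "vder X (\<lambda>p. m (u p) (v p)) p = m (vder X u p) (v p) + m (u p) (vder X v p)"
  proof (rule vder_eqI)
    fix l :: "'v \<Rightarrow> real" assume l: "linear l"
    have "X (\<lambda>q. l (m (u q) (v q))) p =
        X (\<lambda>q. \<Sum>a\<in>E. \<Sum>b\<in>E. l (m a b) * (c a (u q) * c b (v q))) p"
      by (subst ext[OF expand[OF l]]) (rule refl)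
    also have "\<dots> = (\<Sum>a\<in>E. X (\<lambda>q. \<Sum>b\<in>E. l (m a b) * (c a (u q) * c b (v q))) p)"
      by (rule fun_cong[OF vector_field_sum[OF atlas X smooth_functions_sum[OF atlas sm']]])
    also have "\<dots> = (\<Sum>a\<in>E. \<Sum>b\<in>E. X (\<lambda>q. l (m a b) * (c a (u q) * c b (v q))) p)"
      by (rule sum.cong[OF refl]) (rule fun_cong[OF vector_field_sum[OF atlas X sm']])
    also have "\<dots> = (\<Sum>a\<in>E. \<Sum>b\<in>E. l (m a b) *
        (X (\<lambda>q. c a (u q)) p * c b (v p) + c a (u p) * X (\<lambda>q. c b (v q)) p))"
      by (intro sum.cong refl X_term)
    also have "\<dots> = l (m (vder X u p) (v p)) + l (m (u p) (vder X v p))"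
      using expand[OF l, of "vder X u p" "v p"] expand[OF l, of "u p" "vder X v p"]
      by (simp only: vder[OF X u c(1)] vder[OF X v c(1)] sum.distrib distrib_left)
    finally show "l (m (vder X u p) (v p) + m (u p) (vder X v p)) = X (\<lambda>q. l (m (u q) (v q))) p"
      by (simp only: linear_add[OF l])
  qed
qed

lemma vder_const: "X \<in> vector_fields B \<Longrightarrow> vder X (\<lambda>p. a) p = 0"
  by (rule vder_eqI) (simp add: vector_field_const linear_0)

lemma vder_add:
  assumes X: "X \<in> vector_fields B" and u: "smooth_coef u" and v: "smooth_coef v"
  shows "vder X (\<lambda>p. u p + v p) p = vder X u p + vder X v p"
proof (rule vder_eqI)
  fix l :: "'v \<Rightarrow> real" assume l: "linear l"
  then have "(\<lambda>p. l (u p)) \<in> smooth_functions B" "(\<lambda>p. l (v p)) \<in> smooth_functions B"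
    using u v by (simp_all add: smooth_coef_def)
  then show "l (vder X u p + vder X v p) = X (\<lambda>q. l (u q + v q)) p"
    by (simp add: linear_add[OF l] vder[OF X u l] vder[OF X v l] vector_field_add[OF X])
qed

lemma vder_scale:
  assumes X: "X \<in> vector_fields B" and u: "smooth_coef u" and h: "h \<in> smooth_functions B"
  shows "vder X (\<lambda>p. h p *\<^sub>R u p) p = X h p *\<^sub>R u p + h p *\<^sub>R vder X u p"
proof (rule vder_eqI)
  fix l :: "'v \<Rightarrow> real" assume l: "linear l"
  then have "(\<lambda>p. l (u p)) \<in> smooth_functions B"
    using u by (simp add: smooth_coef_def)
  then show "l (X h p *\<^sub>R u p + h p *\<^sub>R vder X u p) = X (\<lambda>q. l (h q *\<^sub>R u q)) p"
    by (simp add: linear_add[OF l] linear_scale[OF l] vder[OF X u l] vector_field_mult[OF X h])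
qed

lemma vder_vf_add:
  assumes "X \<in> vector_fields B" "Y \<in> vector_fields B" "smooth_coef u"
  shows "vder (vf_add X Y) u p = vder X u p + vder Y u p"
  by (rule vder_eqI) (simp add: linear_add vder assms vf_add_def)

lemma vder_vf_scale:
  assumes "X \<in> vector_fields B" "smooth_coef u"
  shows "vder (vf_scale h X) u p = h p *\<^sub>R vder X u p"
  by (rule vder_eqI) (simp add: linear_scale vder assms vf_scale_def)

lemma vder_vf_bracket:
  assumes X: "X \<in> vector_fields B" and Y: "Y \<in> vector_fields B" and u: "smooth_coef u"
  shows "vder (vf_bracket X Y) u p = vder X (vder Y u) p - vder Y (vder X u) p"
proof (rule vder_eqI)
  fix l :: "'v \<Rightarrow> real" assume l: "linear l"
  show "l (vder X (vder Y u) p - vder Y (vder X u) p) = vf_bracket X Y (\<lambda>q. l (u q)) p"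
    by (simp add: linear_diff[OF l] vder[OF X smooth_coef_vder[OF Y u] l]
        vder[OF Y smooth_coef_vder[OF X u] l] vder[OF X u l] vder[OF Y u l] vf_bracket_def)
qed

lemma vder_left_push:
  assumes X: "X \<in> vector_fields B" and u: "smooth_coef u"
  shows "vder (left_push H g X) u p = vder X (\<lambda>q. u (g \<otimes> q)) (inv g \<otimes> p)"
proof (rule vder_eqI)
  fix l :: "'v \<Rightarrow> real" assume l: "linear l"
  have "smooth_coef (\<lambda>q. u (g \<otimes> q))"
    using u smooth_functions_translate by (auto simp: smooth_coef_def)
  from vder[OF X this l]
  show "l (vder X (\<lambda>q. u (g \<otimes> q)) (inv g \<otimes> p)) = left_push H g X (\<lambda>q. l (u q)) p"
    by (simp add: left_push_def)
qed

text \<open>The Leibniz rule with the coefficients of \<open>Y\<close> frozen at \<open>p\<close>: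
  the first term differentiates the coefficients, the second applies \<open>X\<close> to the
  derivative of \<open>f\<close> along the frame field that agrees with \<open>Y\<close> at
  \<open>p\<close>.\<close>

lemma apply_twice:
  assumes X: "X \<in> vector_fields B" and Y: "Y \<in> vector_fields B" and f: "f \<in> smooth_functions B"
  shows "X (Y f) p = \<psi> (vder X (coef Y) p) f p + X (\<psi> (coef Y p) f) p"
proof -
  obtain E :: "'v set" and c where c: "\<And>b. linear (c b)" "\<And>x. (\<Sum>b\<in>E. c b x *\<^sub>R b) = x"
    by (rule fin_dim_coordinates) blast
  note u = smooth_coef_coef[OF Y]
  have cu: "(\<lambda>q. c b (coef Y q)) \<in> smooth_functions B" for b
    using u c(1) by (simp add: smooth_coef_def)
  have ff: "\<psi> b f \<in> smooth_functions B" for b by (rule vector_field_smooth[OF frame_vector_field f])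
  have expand: "\<psi> a f q = (\<Sum>b\<in>E. c b a * \<psi> b f q)" for a q
  proof -
    have "\<psi> a f q = \<psi> (\<Sum>b\<in>E. c b a *\<^sub>R b) f q" by (simp only: c(2))
    then show ?thesis by (simp add: linear_sum[OF frame_linear] linear_scale[OF frame_linear])
  qed
  have "Y f = (\<lambda>q. \<Sum>b\<in>E. c b (coef Y q) * \<psi> b f q)"
    by (intro ext trans[OF coef[OF Y] expand])
  then have "X (Y f) p = (\<Sum>b\<in>E. X (\<lambda>q. c b (coef Y q) * \<psi> b f q) p)"
    using fun_cong[OF vector_field_sum[OF atlas X smooth_functions_mult[OF atlas cu ff]]] by (simp only:)
  also have "\<dots> = (\<Sum>b\<in>E. X (\<lambda>q. c b (coef Y q)) p * \<psi> b f p + c b (coef Y p) * X (\<psi> b f) p)"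
    by (rule sum.cong[OF refl]) (rule fun_cong[OF vector_field_mult[OF X cu ff]])
  finally have XY: "X (Y f) p = (\<Sum>b\<in>E. X (\<lambda>q. c b (coef Y q)) p * \<psi> b f p + c b (coef Y p) * X (\<psi> b f) p)" .
  have dY: "\<psi> (vder X (coef Y) p) f p = (\<Sum>b\<in>E. X (\<lambda>q. c b (coef Y q)) p * \<psi> b f p)"
    by (subst expand) (simp only: vder[OF X u c(1)])
  have "X (\<psi> a f) p = (\<Sum>b\<in>E. c b a * X (\<psi> b f) p)" for a
  proof -
    have "\<psi> a f = (\<lambda>q. \<Sum>b\<in>E. c b a * \<psi> b f q)" by (intro ext expand)
    then have "X (\<psi> a f) p = X (\<lambda>q. \<Sum>b\<in>E. c b a * \<psi> b f q) p" by (simp only:)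
    also have "\<dots> = (\<Sum>b\<in>E. X (\<lambda>q. c b a * \<psi> b f q) p)"
      by (rule fun_cong[OF vector_field_sum[OF atlas X]])
        (rule smooth_functions_mult[OF atlas smooth_functions_const ff])
    also have "\<dots> = (\<Sum>b\<in>E. c b a * X (\<psi> b f) p)"
      by (rule sum.cong[OF refl]) (rule fun_cong[OF vector_field_cmult[OF X ff]])
    finally show ?thesis .
  qed
  from XY dY this[of "coef Y p"] show ?thesis by (simp only: sum.distrib)
qed

text \<open>Antisymmetrising \<open>apply_twice\<close> leaves the derivatives of the coefficients
  and the commutator of the two frozen frame fields, which is the frame field of their Lie
  bracket.\<close>

lemma coef_bracket:
  assumes X: "X \<in> vector_fields B" and Y: "Y \<in> vector_fields B"
  shows "coef (vf_bracket X Y) p = vder X (coef Y) p - vder Y (coef X) p + br (coef X p) (coef Y p)"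
proof (rule coefI)
  fix f
  show "vf_bracket X Y f p = \<psi> (vder X (coef Y) p - vder Y (coef X) p + br (coef X p) (coef Y p)) f p"
  proof (cases "f \<in> smooth_functions B")
    case True
    have "vf_bracket X Y f p = \<psi> (vder X (coef Y) p) f p - \<psi> (vder Y (coef X) p) f p
        + (\<psi> (coef X p) (\<psi> (coef Y p) f) p - \<psi> (coef Y p) (\<psi> (coef X p) f) p)"
      unfolding vf_bracket_def apply_twice[OF X Y True] apply_twice[OF Y X True]
      by (simp add: coef[OF X, of "\<psi> (coef Y p) f"] coef[OF Y, of "\<psi> (coef X p) f"])
    also have "\<psi> (coef X p) (\<psi> (coef Y p) f) p - \<psi> (coef Y p) (\<psi> (coef X p) f) p
        = \<psi> (br (coef X p) (coef Y p)) f p"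
      by (simp add: frame_bracket vf_bracket_def)
    finally show ?thesis
      by (simp add: linear_add[OF frame_linear] linear_diff[OF frame_linear])
  next
    case False
    then show ?thesis
      by (simp add: vector_field_non_smooth[OF vf_bracket_vector_field[OF atlas X Y]]
          vector_field_non_smooth[OF frame_vector_field])
  qed
qed

end

section \<open>The connection of a left symmetric product\<close>

locale left_symmetric_frame = lie_group_frame H B br \<psi>
  for H :: "'h::{t2_space, second_countable_topology} monoid" (structure)
    and B :: "('h, 'e::fin_dim_inner) atlas"
    and br :: "'v::fin_dim_vector \<Rightarrow> 'v \<Rightarrow> 'v" and \<psi> +
  fixes m :: "'v \<Rightarrow> 'v \<Rightarrow> 'v"
  assumes lsa: "left_symmetric_algebra m" and compatible: "compatible_with m br"
begin

lemma bilinear_m: "bilinear m"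
  using lsa by (simp add: left_symmetric_algebra_def)

text \<open>Differentiating coefficients is the connection for which the frame is parallel; the
  tensor \<open>m\<close>, constant in the frame, is added to obtain the prescribed values on frame
  fields.\<close>

definition conn :: "'h operator \<Rightarrow> 'h operator \<Rightarrow> 'h operator" where
  "conn X Y = field_of (\<lambda>p. vder X (coef Y) p + m (coef X p) (coef Y p))"

lemma coef_conn: "coef (conn X Y) = (\<lambda>p. vder X (coef Y) p + m (coef X p) (coef Y p))"
  by (simp add: conn_def fun_eq_iff)

lemma conn_vector_field:
  "X \<in> vector_fields B \<Longrightarrow> Y \<in> vector_fields B \<Longrightarrow> conn X Y \<in> vector_fields B"
  unfolding conn_def
  by (rule field_of_vector_field[OF smooth_coef_add[OF smooth_coef_vder[OF _ smooth_coef_coef]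
          smooth_coef_bilinear_vder(1)[OF bilinear_m smooth_coef_coef smooth_coef_coef]]])

lemma conn_frame: "conn (\<psi> a) (\<psi> b) = \<psi> (m a b)"
proof (rule vector_field_eqI)
  have "coef (\<psi> b) = (\<lambda>p. b)" by (simp add: fun_eq_iff)
  then show "coef (conn (\<psi> a) (\<psi> b)) p = coef (\<psi> (m a b)) p" for p
    by (simp add: coef_conn vder_const frame_vector_field)
qed (simp_all add: conn_vector_field frame_vector_field)

lemmas field_closure = conn_vector_field vf_add_vector_field[OF atlas] vf_diff_vector_field[OF atlas]
  vf_scale_vector_field[OF atlas] vf_bracket_vector_field[OF atlas] left_push_vector_field vector_field_smooth

lemma coef_add_fun: "X \<in> vector_fields B \<Longrightarrow> Y \<in> vector_fields B \<Longrightarrow>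
    coef (vf_add X Y) = (\<lambda>p. coef X p + coef Y p)"
  by (simp add: coef_add fun_eq_iff)

lemma coef_scale_fun: "X \<in> vector_fields B \<Longrightarrow> coef (vf_scale h X) = (\<lambda>p. h p *\<^sub>R coef X p)"
  by (simp add: coef_scale fun_eq_iff)

lemma affine_connection_conn: "affine_connection B conn"
  unfolding affine_connection_def
proof (intro conjI ballI)
  note [simp] = bilinear_ladd[OF bilinear_m] bilinear_radd[OF bilinear_m]
    bilinear_lmul[OF bilinear_m] bilinear_rmul[OF bilinear_m] smooth_coef_coef
  fix X Y assume X: "X \<in> vector_fields B" and Y: "Y \<in> vector_fields B"
  show "conn X Y \<in> vector_fields B" by (rule conn_vector_field[OF X Y])
  fix Z assume Z: "Z \<in> vector_fields B"
  show "conn (vf_add X Y) Z = vf_add (conn X Z) (conn Y Z)"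
    by (rule vector_field_eqI)
      (simp_all add: X Y Z field_closure coef_conn coef_add vder_vf_add)
  show "conn X (vf_add Y Z) = vf_add (conn X Y) (conn X Z)"
    by (rule vector_field_eqI)
      (simp_all add: X Y Z field_closure coef_conn coef_add coef_add_fun vder_add)
next
  note [simp] = bilinear_ladd[OF bilinear_m] bilinear_radd[OF bilinear_m]
    bilinear_lmul[OF bilinear_m] bilinear_rmul[OF bilinear_m] smooth_coef_coef
  fix h X Y assume h: "h \<in> smooth_functions B" and X: "X \<in> vector_fields B" and Y: "Y \<in> vector_fields B"
  show "conn (vf_scale h X) Y = vf_scale h (conn X Y)"
    by (rule vector_field_eqI)
      (simp_all add: h X Y field_closure coef_conn coef_scale vder_vf_scale scaleR_add_right)
  show "conn X (vf_scale h Y) = vf_add (vf_scale (X h) Y) (vf_scale h (conn X Y))"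
    by (rule vector_field_eqI)
      (simp_all add: h X Y field_closure coef_conn coef_scale coef_add coef_scale_fun vder_scale scaleR_add_right)
qed

text \<open>Left translation only reparametrises the coefficients, while the product
  \<open>m\<close> is the same at every point.\<close>

lemma left_invariant_conn: "left_invariant_connection H B conn"
  unfolding left_invariant_connection_def
proof (intro allI ballI)
  fix g X Y assume X: "X \<in> vector_fields B" and Y: "Y \<in> vector_fields B"
  have "coef (left_push H g Y) = (\<lambda>p. coef Y (inv g \<otimes> p))" by (simp add: coef_left_push Y fun_eq_iff)
  moreover have "smooth_coef (\<lambda>p. coef Y (inv g \<otimes> p))"
    using smooth_coef_coef[OF Y] smooth_functions_translate by (auto simp: smooth_coef_def)
  ultimately show "left_push H g (conn X Y) = conn (left_push H g X) (left_push H g Y)"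
    by (intro vector_field_eqI) (simp_all add: X Y field_closure coef_conn coef_left_push vder_left_push)
qed

text \<open>The derivatives of the coefficients occur identically in \<open>coef_bracket\<close>;
  what remains is the commutator of \<open>m\<close> against the Lie bracket, that is,
  compatibility.\<close>

lemma torsion_free_conn: "torsion_free B conn"
  unfolding torsion_free_def
proof (intro ballI)
  fix X Y assume X: "X \<in> vector_fields B" and Y: "Y \<in> vector_fields B"
  have "m a b - m b a = br a b" for a b using compatible by (simp add: compatible_with_def)
  then have "coef (vf_diff (conn X Y) (conn Y X)) p = coef (vf_bracket X Y) p" for p
    by (simp add: X Y coef_diff field_closure coef_conn coef_bracket algebra_simps flip: \<open>\<And>a b. _ = br a b\<close>)
  then show "vf_diff (conn X Y) (conn Y X) = vf_bracket X Y"
    by (intro vector_field_eqI) (simp_all add: X Y field_closure)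
qed

text \<open>Second derivatives combine to the derivative along the bracket, and the two products of
  a coefficient with a derivative of \<open>Z\<close> are symmetric in \<open>X\<close> and
  \<open>Y\<close>, hence cancel. The terms without derivatives are governed by left
  symmetry.\<close>

lemma flat_conn: "flat B conn"
  unfolding flat_def
proof (intro ballI)
  fix X Y Z assume X: "X \<in> vector_fields B" and Y: "Y \<in> vector_fields B" and Z: "Z \<in> vector_fields B"
  note sm = smooth_coef_coef[OF X] smooth_coef_coef[OF Y] smooth_coef_coef[OF Z]
  have twice: "coef (conn X (conn Y Z)) p = vder X (vder Y (coef Z)) p + m (vder X (coef Y) p) (coef Z p)
      + m (coef Y p) (vder X (coef Z) p) + m (coef X p) (vder Y (coef Z) p) + m (coef X p) (m (coef Y p) (coef Z p))"
    if X: "X \<in> vector_fields B" and Y: "Y \<in> vector_fields B" for X Y p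
  proof -
    note sm = smooth_coef_coef[OF X] smooth_coef_coef[OF Y] smooth_coef_coef[OF Z]
    have "vder X (\<lambda>p. vder Y (coef Z) p + m (coef Y p) (coef Z p)) p
        = vder X (vder Y (coef Z)) p + (m (vder X (coef Y) p) (coef Z p) + m (coef Y p) (vder X (coef Z) p))"
      by (subst vder_add[OF X smooth_coef_vder[OF Y sm(3)] smooth_coef_bilinear_vder(1)[OF bilinear_m sm(2,3)]])
        (simp add: smooth_coef_bilinear_vder(2)[OF bilinear_m sm(2,3) X])
    then show ?thesis
      by (simp add: coef_conn bilinear_radd[OF bilinear_m] algebra_simps)
  qed
  \<comment> \<open>Left symmetry read through compatibility: left multiplication is a
    representation of the Lie algebra.\<close>
  have lsa': "m a (m b c) - m b (m a c) = m (br a b) c" for a b c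
  proof -
    have "br a b = m a b - m b a" using compatible by (simp add: compatible_with_def)
    then have "m (br a b) c = m (m a b) c - m (m b a) c" by (simp add: bilinear_lsub[OF bilinear_m])
    moreover have "m (m a b) c = m (m b a) c - m b (m a c) + m a (m b c)"
      using lsa unfolding left_symmetric_algebra_def by (metis diff_eq_eq)
    ultimately show ?thesis by simp
  qed
  have "coef (vf_diff (conn X (conn Y Z)) (conn Y (conn X Z))) p = coef (conn (vf_bracket X Y) Z) p" for p
    by (simp add: X Y Z coef_diff field_closure twice coef_conn[of "vf_bracket X Y"] coef_bracket
        vder_vf_bracket sm bilinear_ladd[OF bilinear_m] bilinear_lsub[OF bilinear_m] flip: lsa')
  then show "vf_diff (conn X (conn Y Z)) (conn Y (conn X Z)) = conn (vf_bracket X Y) Z"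
    by (intro vector_field_eqI) (simp_all add: X Y Z field_closure)
qed

lemma left_invariant_affine_structure_conn: "left_invariant_affine_structure H B conn"
  by (simp add: left_invariant_affine_structure_def affine_connection_conn left_invariant_conn
      flat_conn torsion_free_conn)

end

section \<open>The double Lie algebra\<close>

lemma linear_pairing: "linear (pairing \<alpha>)"
  using pairing[of \<alpha>] by simp

lemma dual_eqI: "(\<And>x. pairing \<alpha> x = pairing \<beta> x) \<Longrightarrow> \<alpha> = \<beta>"
  by (metis ext pairing_inject)

lemmas pairing_simps = zero_dual.rep_eq plus_dual.rep_eq uminus_dual.rep_eq minus_dual.rep_eq
  scaleR_dual.rep_eq

lemma pairing_sum: "pairing (\<Sum>i\<in>I. \<alpha> i) x = (\<Sum>i\<in>I. pairing (\<alpha> i) x)"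
  by (induction I rule: infinite_finite_induct) (simp_all add: pairing_simps)

text \<open>The coordinate functionals span the dual. This puts the double into the class of spaces
  that can index a frame.\<close>

instance dual :: (fin_dim_vector) fin_dim_vector
proof
  obtain B :: "'a set" and c where B: "finite B" and c: "\<And>b. linear (c b)"
      "\<And>x. (\<Sum>b\<in>B. c b x *\<^sub>R b) = x"
    by (rule fin_dim_coordinates) blast
  let ?D = "(\<lambda>b. Abs_dual (c b)) ` B"
  have "\<alpha> = (\<Sum>b\<in>B. pairing \<alpha> b *\<^sub>R Abs_dual (c b))" for \<alpha> :: "'a dual"
  proof (rule dual_eqI)
    fix x
    have "pairing \<alpha> x = pairing \<alpha> (\<Sum>b\<in>B. c b x *\<^sub>R b)" by (simp only: c(2))
    then show "pairing \<alpha> x = pairing (\<Sum>b\<in>B. pairing \<alpha> b *\<^sub>R Abs_dual (c b)) x"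
      by (simp add: linear_sum[OF linear_pairing] linear_scale[OF linear_pairing] pairing_sum
          pairing_simps Abs_dual_inverse c(1) mult.commute)
  qed
  moreover have "(\<Sum>b\<in>B. pairing \<alpha> b *\<^sub>R Abs_dual (c b)) \<in> span ?D" for \<alpha> :: "'a dual"
    by (intro span_sum span_scale span_base imageI)
  ultimately have "\<alpha> \<in> span ?D" for \<alpha> :: "'a dual" by metis
  then have "span ?D = UNIV" by (intro equalityI subset_UNIV subsetI)
  moreover have "finite ?D" using B by simp
  ultimately show "\<exists>B::'a dual set. finite B \<and> (\<forall>x. \<exists>c. x = (\<Sum>b\<in>B. c b *\<^sub>R b))"
    by (intro exI[of _ ?D] conjI allI finite_span_imp_spanning)
qed

section \<open>The left symmetric products of an invertible r-matrix\<close>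

locale invertible_r_matrix =
  fixes br :: "'g::real_vector \<Rightarrow> 'g \<Rightarrow> 'g" and r :: "'g dual \<Rightarrow> 'g"
  assumes lie_algebra: "lie_algebra br" and skew: "skew_map r" and cybe: "cybe br r" and bij: "bij r"
begin

lemma bilinear_br: "bilinear br"
  and jacobi: "br x (br y z) + br y (br z x) + br z (br x y) = 0"
  using lie_algebra by (simp_all add: lie_algebra_def)

lemma br_anticomm: "br y x = - br x y"
proof -
  have "br (x + y) (x + y) = 0" "br x x = 0" "br y y = 0"
    using lie_algebra by (simp_all only: lie_algebra_def)
  then have "br y x + br x y = 0"
    by (simp add: bilinear_ladd[OF bilinear_br] bilinear_radd[OF bilinear_br])
  then show ?thesis by (simp only: eq_neg_iff_add_eq_0)
qed

lemma linear_br: "linear (br x)" "linear (\<lambda>x. br x y)"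
  using bilinear_br by (simp_all add: bilinear_def)

lemma pairing_coad [simp]: "pairing (coad br x \<alpha>) y = - pairing \<alpha> (br x y)"
proof -
  have "linear (\<lambda>y. - pairing \<alpha> (br x y))"
    using linear_compose[OF linear_br(1)[of x] linear_pairing[of \<alpha>]]
    by (intro linear_compose_neg) (simp add: comp_def)
  then show ?thesis by (simp add: coad_def Abs_dual_inverse)
qed

lemma linear_coad: "linear (coad br x)" "linear (\<lambda>x. coad br x \<alpha>)"
  by (intro linearI dual_eqI;
      simp add: pairing_simps linear_add[OF linear_br(2)] linear_scale[OF linear_br(2)]
        linear_add[OF linear_pairing] linear_scale[OF linear_pairing])+

text \<open>The Jacobi identity in transposed form: the coadjoint action is a
  representation.\<close>

lemma coad_bracket: "coad br (br x y) \<gamma> = coad br x (coad br y \<gamma>) - coad br y (coad br x \<gamma>)"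
proof (rule dual_eqI)
  fix z
  have "br x (br y z) - br y (br x z) - br (br x y) z = 0"
    using jacobi[of x y z] unfolding br_anticomm[of z x] br_anticomm[of z "br x y"]
    by (simp add: linear_neg[OF linear_br(1)])
  then have "br (br x y) z = br x (br y z) - br y (br x z)" by simp
  then show "pairing (coad br (br x y) \<gamma>) z = pairing (coad br x (coad br y \<gamma>) - coad br y (coad br x \<gamma>)) z"
    by (simp add: pairing_simps linear_diff[OF linear_pairing])
qed

lemma linear_r: "linear r" and r_skew: "pairing \<beta> (r \<alpha>) = - pairing \<alpha> (r \<beta>)"
  using skew unfolding skew_map_def by blast+

abbreviation (input) s where "s \<equiv> the_inv r"

lemma r_s [simp]: "r (s x) = x" and s_r [simp]: "s (r \<alpha>) = \<alpha>"
  using bij by (simp_all add: f_the_inv_into_f_bij_betw bij_is_inj the_inv_f_f)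

lemma linear_s: "linear s"
proof (rule linearI)
  show "s (x + y) = s x + s y" for x y
    using s_r[of "s x + s y"] by (simp add: linear_add[OF linear_r])
  show "s (c *\<^sub>R x) = c *\<^sub>R s x" for c x
    using s_r[of "c *\<^sub>R s x"] by (simp add: linear_scale[OF linear_r])
qed

text \<open>Skewness gives \<open>pairing (s z) x = - pairing (s x) z\<close>, so the values of all
  functionals at \<open>x\<close> determine \<open>s x\<close>. Uniqueness in the definition of
  \<open>dual_coad\<close> follows from this.\<close>

lemma dual_separates:
  fixes x y :: 'g
  assumes "\<And>\<beta>. pairing \<beta> x = pairing \<beta> y"
  shows "x = y"
proof -
  have "pairing (s x) z = pairing (s y) z" for z
    using assms[of "s z"] r_skew[of "s z" "s x"] r_skew[of "s z" "s y"] by simp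
  then have "s x = s y" by (rule dual_eqI)
  then show ?thesis by (metis r_s)
qed

abbreviation P where "P \<equiv> symp_prod br r"

text \<open>The symplectic form is the pairing read through \<open>s\<close>, so its defining
  equation for the product transports the coadjoint action by \<open>r\<close>.\<close>

lemma symp_prod_eq: "P x y = r (coad br x (s y))"
  unfolding symp_prod_def
proof (rule the_equality)
  show "\<forall>z. symp_form r (r (coad br x (s y))) z = - symp_form r y (br x z)"
    by (simp add: symp_form_def)
  fix w assume w: "\<forall>z. symp_form r w z = - symp_form r y (br x z)"
  have "s w = coad br x (s y)" by (rule dual_eqI) (use w in \<open>simp add: symp_form_def\<close>)
  then show "w = r (coad br x (s y))" by (metis r_s)
qed

text \<open>Paired with an arbitrary functional and rearranged by skewness, this homomorphism
  property is the Yang-Baxter equation.\<close>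

lemma r_dual_bracket: "r (dual_bracket br r \<alpha> \<beta>) = br (r \<alpha>) (r \<beta>)"
proof (rule dual_separates)
  fix \<gamma>
  have "pairing \<gamma> (br (r \<alpha>) (r \<beta>)) + pairing \<alpha> (br (r \<beta>) (r \<gamma>)) + pairing \<beta> (br (r \<gamma>) (r \<alpha>)) = 0"
    using cybe by (simp add: cybe_def)
  moreover have "pairing \<gamma> (r (dual_bracket br r \<alpha> \<beta>)) = - pairing (dual_bracket br r \<alpha> \<beta>) (r \<gamma>)"
    by (rule r_skew)
  ultimately show "pairing \<gamma> (r (dual_bracket br r \<alpha> \<beta>)) = pairing \<gamma> (br (r \<alpha>) (r \<beta>))"
    using br_anticomm[of "r \<gamma>" "r \<alpha>"]
    by (simp add: dual_bracket_def pairing_simps linear_neg[OF linear_pairing])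
qed

text \<open>The homomorphism property of \<open>r\<close>, applied to \<open>s x\<close> and
  \<open>s y\<close>.\<close>

lemma symp_prod_compatible: "P x y - P y x = br x y"
  using r_dual_bracket[of "s x" "s y"]
  by (simp add: symp_prod_eq dual_bracket_def linear_diff[OF linear_r])

lemma symp_prod_bracket: "P (br x y) z = P x (P y z) - P y (P x z)"
  by (simp add: symp_prod_eq coad_bracket linear_diff[OF linear_r])

lemma linear_symp_prod: "linear (P x)" "linear (\<lambda>x. P x y)"
  by (simp_all add: symp_prod_eq linear_iff linear_add[OF linear_s] linear_scale[OF linear_s]
      linear_add[OF linear_r] linear_scale[OF linear_r] linear_add[OF linear_coad(1)]
      linear_scale[OF linear_coad(1)] linear_add[OF linear_coad(2)] linear_scale[OF linear_coad(2)])

text \<open>Left multiplication represents the bracket, and the bracket is the commutator of the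
  product; together these give left symmetry.\<close>

lemma symp_prod_left_symmetric: "P (P x y) z - P x (P y z) = P (P y x) z - P y (P x z)"
proof -
  have "P (P x y) z - P (P y x) z = P (br x y) z"
    by (simp add: linear_diff[OF linear_symp_prod(2)] flip: symp_prod_compatible)
  then show ?thesis by (simp add: symp_prod_bracket algebra_simps)
qed

text \<open>Compatibility writes \<open>P (r \<alpha>) y\<close> as a bracket plus the transported
  coadjoint action of \<open>y\<close> on \<open>\<alpha>\<close>; skewness of \<open>r\<close>
  turns these into the two terms of the dual bracket. This identity merges the mixed term of the
  double product with the product on the Lie algebra.\<close>

lemma dual_coad_eq: "dual_coad br r \<alpha> y = P (r \<alpha>) y"
  unfolding dual_coad_def
proof (rule the_equality)
  have eq: "P (r \<alpha>) y = br (r \<alpha>) y + r (coad br y \<alpha>)"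
    using symp_prod_compatible[of "r \<alpha>" y] by (simp add: symp_prod_eq[of y] algebra_simps)
  show *: "\<forall>\<beta>. pairing \<beta> (P (r \<alpha>) y) = - pairing (dual_bracket br r \<alpha> \<beta>) y"
  proof
    fix \<beta>
    have "pairing \<beta> (r (coad br y \<alpha>)) = - pairing (coad br y \<alpha>) (r \<beta>)" by (rule r_skew)
    then show "pairing \<beta> (P (r \<alpha>) y) = - pairing (dual_bracket br r \<alpha> \<beta>) y"
      using br_anticomm[of "r \<beta>" y]
      by (simp add: eq linear_add[OF linear_pairing] dual_bracket_def pairing_simps linear_neg[OF linear_pairing])
  qed
  fix w assume "\<forall>\<beta>. pairing \<beta> w = - pairing (dual_bracket br r \<alpha> \<beta>) y"
  with * show "w = P (r \<alpha>) y" by (intro dual_separates) simp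
qed

text \<open>Identifying the dual with the Lie algebra by \<open>r\<close>, the product on the double is two copies of
  the left multiplication by \<open>x + r \<alpha>\<close>.\<close>

definition total :: "'g \<times> 'g dual \<Rightarrow> 'g" where
  "total a = fst a + r (snd a)"

text \<open>In the second component the coadjoint actions of \<open>r \<alpha>\<close> and of
  \<open>x\<close> add up to that of \<open>total a\<close>; conjugation by \<open>r\<close> gives
  it the shape of the first.\<close>

lemma double_prod_eq:
  "double_prod br r a b = (P (total a) (fst b), s (P (total a) (r (snd b))))"
  by (simp add: double_prod_def dual_prod_def dual_coad_eq total_def case_prod_unfold
      symp_prod_eq[of _ "r _"] linear_add[OF linear_coad(2)] linear_add[OF linear_symp_prod(2)] add.commute)

text \<open>Both components undergo the same left multiplication, which therefore passes to their
  sum.\<close>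

lemma total_double_prod: "total (double_prod br r a b) = P (total a) (total b)"
  by (simp add: double_prod_eq total_def[of "(_, _)"] total_def[of b] linear_add[OF linear_symp_prod(1)])

text \<open>Since \<open>total\<close> is multiplicative, each component of the identity is left
  symmetry of \<open>P\<close> for \<open>total a\<close>, \<open>total b\<close> and either
  \<open>fst c\<close> or \<open>r (snd c)\<close>.\<close>

lemma left_symmetric_double_prod: "left_symmetric_algebra (double_prod br r)"
  unfolding left_symmetric_algebra_def
proof (intro conjI allI)
  have total: "total (a + b) = total a + total b" "total (c *\<^sub>R a) = c *\<^sub>R total a" for a b c
    by (simp_all add: total_def linear_add[OF linear_r] linear_scale[OF linear_r] scaleR_add_right)
  note lin = linear_add[OF linear_symp_prod(1)] linear_scale[OF linear_symp_prod(1)]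
    linear_add[OF linear_symp_prod(2)] linear_scale[OF linear_symp_prod(2)]
    linear_add[OF linear_s] linear_scale[OF linear_s] linear_add[OF linear_r] linear_scale[OF linear_r]
  show "bilinear (double_prod br r)"
    unfolding bilinear_def by (intro conjI allI linearI) (simp_all add: double_prod_eq total lin)
  fix a b c
  show "double_prod br r (double_prod br r a b) c - double_prod br r a (double_prod br r b c) =
      double_prod br r (double_prod br r b a) c - double_prod br r b (double_prod br r a c)"
    unfolding double_prod_eq[of _ c] double_prod_eq[of _ "(_, _)"] total_double_prod
    by (simp add: symp_prod_left_symmetric flip: linear_diff[OF linear_s])
qed

text \<open>The mixed terms and the dual bracket match by definition after antisymmetrisation; the
  remaining term \<open>P x y - P y x\<close> is covered by
  \<open>symp_prod_compatible\<close>.\<close>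

lemma compatible_double_prod: "compatible_with (double_prod br r) (double_bracket br r)"
proof -
  have "double_prod br r (x, \<alpha>) (y, \<beta>) - double_prod br r (y, \<beta>) (x, \<alpha>) =
      double_bracket br r (x, \<alpha>) (y, \<beta>)" for x y \<alpha> \<beta>
    using symp_prod_compatible[of x y]
    by (simp add: double_prod_def double_bracket_def dual_prod_def dual_bracket_def algebra_simps)
  then show ?thesis by (simp add: compatible_with_def)
qed

end

theorem theorem3p0p1:
  fixes br :: "'g::fin_dim_vector \<Rightarrow> 'g \<Rightarrow> 'g"
    and G :: "'k::{t2_space, second_countable_topology} monoid"
    and A :: "('k, 'd::fin_dim_inner) atlas"
    and \<phi> :: "'g \<Rightarrow> 'k operator"
    and r :: "'g dual \<Rightarrow> 'g"
  assumes "lie_algebra br"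
    and "lie_group G A"
    and "is_lie_algebra_of br G A \<phi>"
    and "skew_map r"
    and "cybe br r"
    and "bij r"
  shows "left_symmetric_algebra (double_prod br r)
    \<and> compatible_with (double_prod br r) (double_bracket br r)
    \<and> (\<forall>(H :: 'h::{t2_space, second_countable_topology} monoid)
          (B :: ('h, 'e::fin_dim_inner) atlas) \<psi>.
        lie_group H B \<and> is_lie_algebra_of (double_bracket br r) H B \<psi> \<longrightarrow>
        (\<exists>D. left_invariant_affine_structure H B D \<and>
             (\<forall>a b. D (\<psi> a) (\<psi> b) = \<psi> (double_prod br r a b))))"
proof (intro conjI allI impI)
  interpret invertible_r_matrix br r
    using assms by unfold_locales
  show lsa: "left_symmetric_algebra (double_prod br r)" by (rule left_symmetric_double_prod)
  show compat: "compatible_with (double_prod br r) (double_bracket br r)" by (rule compatible_double_prod)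
  fix H :: "'h monoid" and B :: "('h, 'e) atlas" and \<psi>
  assume H: "lie_group H B \<and> is_lie_algebra_of (double_bracket br r) H B \<psi>"
  interpret H: left_symmetric_frame H B "double_bracket br r" \<psi> "double_prod br r"
    using H lsa compat by unfold_locales auto
  show "\<exists>D. left_invariant_affine_structure H B D \<and>
      (\<forall>a b. D (\<psi> a) (\<psi> b) = \<psi> (double_prod br r a b))"
    using H.left_invariant_affine_structure_conn H.conn_frame by blast
qed

end
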